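(* Consider $\mathbb{Z}_2$-laminated modular data $(\Phi,0,S,T)$ and $(\Phi',0',S',T')$, written in the block form of the context with parameters $x,r,\vec a,\vec d,\vec s,\vec t,A,D$ and $x',r',\vec a\,',\vec d\,',\vec s\,',\vec t\,',A',D'$ respectively. (a) There are integers $M>0$, $L\ge0$, $N>0$ such that $2x=1/\sqrt M$, $N$ and $4^L$ divide $4M$, $2^{1-L}\sqrt M\,\vec a\in\mathbb{Z}^m$, $2\sqrt{M/N}\,\vec d\in\mathbb{Z}^n$, and the gcd over all components $2^{1-L}\sqrt M a_i$ is $1$ (likewise for the components $2\sqrt{M/N}\,d_k$). Write $M',L',N'$ for the corresponding integers for $(\Phi',0',S',T')$. (b) Suppose $x=x'$ and $r=r'$. Then the following defines modular data: $$\widehat S=\begin{pmatrix}x&x&\vec a&\vec d\,'\\ x&x&\vec a&-\vec d\,'\\ \vec a^{T}&\vec a^{T}&A&0\\ \vec d\,'^{T}&-\vec d\,'^{T}&0&D'\end{pmatrix},\qquad \widehat T=\mathrm{diag}(r,r;\vec s;\vec t\,').$$ (c) Suppose $x>x'$ and $r=-r'\omega$ for some third root $\omega$ of $1$. Define $x_\pm=x\pm x'$. Then $$\widehat S=\begin{pmatrix}x_-&x_+&\vec a&\vec a\,'\\ x_+&x_-&\vec a&-\vec a\,'\\ \vec a^{T}&\vec a^{T}&A&0\\ \vec a\,'^{T}&-\vec a\,'^{T}&0&-A'\end{pmatrix},\qquad \widehat T=\mathrm{diag}(r,r;\vec s;-\omega\vec s\,')$$ satisfies all conditions of modular data except possibly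 that the fusion coefficients are nonnegative integers. Its fusion coefficients are all integers iff $(M'-M)\mid 4$ and both $L>0$, $L'>0$. $\widehat S,\widehat T$ define modular data if in addition $N'_{\mathfrak{a}'_k,\mathfrak{a}'_{k'},\mathfrak{a}'_{k''}}\le 8^{L'}/(M'-M)$ for all $k,k',k''$, where $N'_{\cdot,\cdot,\cdot}$ denotes the fusion coefficients of $(\Phi',0',S',T')$.
   Context: Modular data $(\Phi,0,S,T)$ consists of a finite set $\Phi$, $0\in\Phi$, and complex matrices $S,T$ indexed by $\Phi$ such that: $S,T$ are unitary, $S$ is symmetric, $T$ is diagonal; $S^2=(ST)^3$, $S^4=I$; $C:=S^2$ is a permutation matrix and row $0$ of $S$ consists of nonzero real numbers; and for all $i,j,k$ the fusion coefficients $N_{i,j}^k:=\sum_{l\in\Phi}S_{i,l}S_{j,l}\overline{S_{k,l}}/S_{0,l}$ are nonnegative integers. $N_{i,j,k}:=N_{i,j}^{Ck}$. It is unitary if row $0$ of $S$ is strictly positive. Throughout, modular data is assumed unitary with real matrix $S$ (so $C=I$). Such modular data is called $\mathbb{Z}_2$-laminated if $\Phi$ can be written as $\Phi=(0,\mathfrak{b};\mathfrak{a}_1,\dots,\mathfrak{a}_m;\mathfrak{d}_1,\dots,\mathfrak{d}_n)$ ($m,n\ge1$) such that $S_{0,\mathfrak{b}}=S_{0,0}$, $N_{\mathfrak{b},\mathfrak{a}_i}^{\mathfrak{a}_i}\ne0$, $T_{\mathfrak{b},\mathfrak{b}}=T_{0,0}$ and $S_{\mathfrak{b},\mathfrak{d}_j}<0$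 for all $i,j$. Equivalently, $S$ and $T$ have the block form $$S=\begin{pmatrix}x&x&\vec a&\vec d\\ x&x&\vec a&-\vec d\\ \vec a^{T}&\vec a^{T}&A&0\\ \vec d^{T}&-\vec d^{T}&0&D\end{pmatrix},\qquad T=\mathrm{diag}(r,r;\vec s;\vec t),$$ with $x$ a real number, $\vec a\in\mathbb{R}^m$, $\vec d\in\mathbb{R}^n$ row vectors, $A,D$ real square matrices, and $r$, and the components of $\vec s,\vec t$, complex numbers of modulus 1. The sizes $m',n'$ for the second modular data need not equal $m,n$. *)

theory Defs
  imports "HOL-Analysis.Analysis"
begin

definition unitary_matrix :: "complex^'p^'p \<Rightarrow> bool" where
  "unitary_matrix U \<longleftrightarrow>
     U ** map_matrix cnj (transpose U) = mat 1 \<and> map_matrix cnj (transpose U) ** U = mat 1"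

definition diagonal_matrix :: "'a::zero^'p^'p \<Rightarrow> bool" where
  "diagonal_matrix D \<longleftrightarrow> (\<forall>i j. i \<noteq> j \<longrightarrow> D $ i $ j = 0)"

definition permutation_matrix :: "'a::{zero,one}^'p^'p \<Rightarrow> bool" where
  "permutation_matrix P \<longleftrightarrow>
     (\<exists>\<pi>. bij \<pi> \<and> (\<forall>i j. P $ i $ j = (if j = \<pi> i then 1 else 0)))"


text \<open>
  The finite label set \<open>\<Phi>\<close> is the universe of a finite type, and \<open>z\<close> is the label written 0
  on paper. Products of matrices are spelled out with \<open>**\<close>, because \<open>^\<close> and \<open>*\<close> act
  componentwise on vectors.
\<close>

text \<open>The coefficient \<open>N\<^bsub>i,j\<^esub>\<^bsup>k\<^esup>\<close>.\<close>

definition fusion :: "'p \<Rightarrow> complex^'p^'p \<Rightarrow> 'p \<Rightarrow> 'p \<Rightarrow> 'p \<Rightarrow> complex" where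
  "fusion z S i j k = (\<Sum>l\<in>UNIV. S $ i $ l * S $ j $ l * cnj (S $ k $ l) / S $ z $ l)"

text \<open>The permutation \<open>C\<close> of the labels whose permutation matrix is the square of \<open>S\<close>.\<close>

definition charge_conj :: "complex^'p^'p \<Rightarrow> 'p \<Rightarrow> 'p" where
  "charge_conj S k = (THE l. (S ** S) $ k $ l = 1)"

text \<open>The coefficient \<open>N\<^bsub>i,j,k\<^esub>\<close>.\<close>

definition fusion3 :: "'p \<Rightarrow> complex^'p^'p \<Rightarrow> 'p \<Rightarrow> 'p \<Rightarrow> 'p \<Rightarrow> complex" where
  "fusion3 z S i j k = fusion z S i j (charge_conj S k)"

text \<open>All conditions on modular data except the one on the fusion coefficients.\<close>

definition pre_modular_data :: "'p \<Rightarrow> complex^'p^'p \<Rightarrow> complex^'p^'p \<Rightarrow> bool" where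
  "pre_modular_data z S T \<longleftrightarrow>
     unitary_matrix S \<and> unitary_matrix T \<and> transpose S = S \<and> diagonal_matrix T \<and>
     S ** S = (S ** T) ** (S ** T) ** (S ** T) \<and>
     S ** S ** S ** S = mat 1 \<and>
     permutation_matrix (S ** S) \<and>
     (\<forall>l. S $ z $ l \<in> \<real> \<and> S $ z $ l \<noteq> 0)"

definition modular_data :: "'p \<Rightarrow> complex^'p^'p \<Rightarrow> complex^'p^'p \<Rightarrow> bool" where
  "modular_data z S T \<longleftrightarrow> pre_modular_data z S T \<and> (\<forall>i j k. fusion z S i j k \<in> \<nat>)"

text \<open>
  The standing assumptions: unitarity in the sense of modular data (row \<open>z\<close> is strictly
  positive), and \<open>S\<close> is a real matrix.
\<close>

definition unitary_real :: "'p \<Rightarrow> complex^'p^'p \<Rightarrow> bool" where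
  "unitary_real z S \<longleftrightarrow>
     (\<forall>l. S $ z $ l \<in> \<real> \<and> 0 < Re (S $ z $ l)) \<and> (\<forall>i j. S $ i $ j \<in> \<real>)"


text \<open>
  The labels \<open>(0, b; a\<^sub>1, \<dots>, a\<^sub>m; d\<^sub>1, \<dots>, d\<^sub>n)\<close>, with the index sets of the \<open>a\<close>'s and the
  \<open>d\<close>'s given by two finite types (nonempty, so \<open>m\<close> and \<open>n\<close> are at least 1).
\<close>

datatype ('m, 'n) lam_index = Lab_0 | Lab_b | Lab_a 'm | Lab_d 'n

lemma UNIV_lam_index: "(UNIV :: ('m, 'n) lam_index set) = {Lab_0, Lab_b} \<union> range Lab_a \<union> range Lab_d"
proof -
  have "x \<in> {Lab_0, Lab_b} \<union> range Lab_a \<union> range Lab_d" for x :: "('m, 'n) lam_index"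
    by (cases x) auto
  then show ?thesis by blast
qed

instance lam_index :: (finite, finite) finite
  by standard (simp add: UNIV_lam_index)

text \<open>The bijection \<open>e\<close> is the way of writing \<open>\<Phi>\<close> as such a list.\<close>

definition Z2_laminated ::
  "'p \<Rightarrow> complex^'p^'p \<Rightarrow> complex^'p^'p \<Rightarrow> (('m::finite, 'n::finite) lam_index \<Rightarrow> 'p) \<Rightarrow> bool" where
  "Z2_laminated z S T e \<longleftrightarrow>
     modular_data z S T \<and> unitary_real z S \<and>
     bij e \<and> e Lab_0 = z \<and>
     S $ z $ e Lab_b = S $ z $ z \<and>
     (\<forall>i. fusion z S (e Lab_b) (e (Lab_a i)) (e (Lab_a i)) \<noteq> 0) \<and>
     T $ e Lab_b $ e Lab_b = T $ z $ z \<and>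
     (\<forall>j. Re (S $ e Lab_b $ e (Lab_d j)) < 0)"

definition reindex :: "('q \<Rightarrow> 'p) \<Rightarrow> 'a^'p^'p \<Rightarrow> 'a^'q^'q" where
  "reindex e A = (\<chi> i j. A $ e i $ e j)"

fun block_entry ::
  "real \<Rightarrow> real \<Rightarrow> real^'m \<Rightarrow> real^'n \<Rightarrow> real^'m^'m \<Rightarrow> real^'n^'n \<Rightarrow>
   ('m, 'n) lam_index \<Rightarrow> ('m, 'n) lam_index \<Rightarrow> real" where
  "block_entry p q a d A D Lab_0 Lab_0 = p"
| "block_entry p q a d A D Lab_0 Lab_b = q"
| "block_entry p q a d A D Lab_0 (Lab_a j) = a $ j"
| "block_entry p q a d A D Lab_0 (Lab_d j) = d $ j"
| "block_entry p q a d A D Lab_b Lab_0 = q"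
| "block_entry p q a d A D Lab_b Lab_b = p"
| "block_entry p q a d A D Lab_b (Lab_a j) = a $ j"
| "block_entry p q a d A D Lab_b (Lab_d j) = - d $ j"
| "block_entry p q a d A D (Lab_a i) Lab_0 = a $ i"
| "block_entry p q a d A D (Lab_a i) Lab_b = a $ i"
| "block_entry p q a d A D (Lab_a i) (Lab_a j) = A $ i $ j"
| "block_entry p q a d A D (Lab_a i) (Lab_d j) = 0"
| "block_entry p q a d A D (Lab_d i) Lab_0 = d $ i"
| "block_entry p q a d A D (Lab_d i) Lab_b = - d $ i"
| "block_entry p q a d A D (Lab_d i) (Lab_a j) = 0"
| "block_entry p q a d A D (Lab_d i) (Lab_d j) = D $ i $ j"

definition block_S ::
  "real \<Rightarrow> real \<Rightarrow> real^'m \<Rightarrow> real^'n \<Rightarrow> real^'m^'m \<Rightarrow> real^'n^'n \<Rightarrow>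
   complex^('m::finite, 'n::finite) lam_index^('m, 'n) lam_index" where
  "block_S p q a d A D = (\<chi> i j. complex_of_real (block_entry p q a d A D i j))"

definition block_T ::
  "complex \<Rightarrow> complex^'m \<Rightarrow> complex^'n \<Rightarrow>
   complex^('m::finite, 'n::finite) lam_index^('m, 'n) lam_index" where
  "block_T r s t = (\<chi> i j. if i \<noteq> j then 0 else
     (case i of Lab_0 \<Rightarrow> r | Lab_b \<Rightarrow> r | Lab_a k \<Rightarrow> s $ k | Lab_d k \<Rightarrow> t $ k))"

text \<open>A real vector whose components are integers with greatest common divisor 1.\<close>

definition primitive_integral :: "real^'m \<Rightarrow> bool" where
  "primitive_integral v \<longleftrightarrow> (\<exists>c :: 'm \<Rightarrow> int. (\<forall>i. v $ i = of_int (c i)) \<and> Gcd (range c) = 1)"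

definition laminated_integers :: "real \<Rightarrow> real^'m \<Rightarrow> real^'n \<Rightarrow> int \<Rightarrow> nat \<Rightarrow> int \<Rightarrow> bool" where
  "laminated_integers x a d M L N \<longleftrightarrow>
     0 < M \<and> 0 < N \<and> 2 * x = 1 / sqrt (of_int M) \<and> N dvd 4 * M \<and> 4 ^ L dvd 4 * M \<and>
     primitive_integral ((2 powi (1 - int L) * sqrt (of_int M)) *\<^sub>R a) \<and>
     primitive_integral ((2 * sqrt (of_int M / of_int N)) *\<^sub>R d)"


text \<open>
  The conditions defining laminated data already force the block form, so assuming the block
  form in addition to them only names its parameters.
\<close>

lemma Z2_laminated_block_form:
  fixes e :: "('m::finite, 'n::finite) lam_index \<Rightarrow> 'p::finite"
  assumes lam: "Z2_laminated z S T e"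
  shows "\<exists>x a d A D r s t.
    reindex e S = block_S x x a d A D \<and> reindex e T = block_T r s t \<and>
    norm r = 1 \<and> (\<forall>i. norm (s $ i) = 1) \<and> (\<forall>j. norm (t $ j) = 1)"
proof -
  define b where "b = e Lab_b"
  define u where "u i j = Re (S $ i $ j)" for i j
  define w where "w i = T $ i $ i" for i
  have pre: "pre_modular_data z S T" and nat: "\<And>i j k. fusion z S i j k \<in> \<nat>"
    and real: "\<And>i j. S $ i $ j \<in> \<real>" and pos: "\<And>l. 0 < u z l"
    and "bij e" and e0: "e Lab_0 = z" and zb: "u z b = u z z"
    and fixpt: "\<And>i. fusion z S b (e (Lab_a i)) (e (Lab_a i)) \<noteq> 0"
    and wb: "w b = w z" and neg: "\<And>j. u b (e (Lab_d j)) < 0"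
    using lam by (auto simp: Z2_laminated_def modular_data_def unitary_real_def b_def u_def w_def)
  have Su: "S $ i $ j = complex_of_real (u i j)" for i j
    using real[of i j] by (simp add: u_def of_real_Re)
  have US: "unitary_matrix S" and UT: "unitary_matrix T" and symS: "transpose S = S"
    and diag: "diagonal_matrix T"
    and STcube: "S ** S = (S ** T) ** (S ** T) ** (S ** T)"
    using pre by (auto simp: pre_modular_data_def)
  have sym: "u i j = u j i" for i j
  proof -
    have "transpose S $ i $ j = S $ i $ j" by (simp only: symS)
    then show ?thesis by (simp add: transpose_def u_def)
  qed
  have "map_matrix cnj (transpose S) = S"
    using symS by (simp add: vec_eq_iff Su)
  then have SS: "S ** S = mat 1" using US by (simp add: unitary_matrix_def)
  have orth: "(\<Sum>l\<in>UNIV. u i l * u j l) = (if i = j then 1 else 0)" for i j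
  proof -
    have "complex_of_real (\<Sum>l\<in>UNIV. u i l * u l j) = (S ** S) $ i $ j"
      by (simp add: matrix_matrix_mult_def Su)
    also have "\<dots> = complex_of_real (if i = j then 1 else 0)" by (simp add: SS mat_def)
    finally have "(\<Sum>l\<in>UNIV. u i l * u l j) = (if i = j then 1 else 0)" by (simp only: of_real_eq_iff)
    moreover have "(\<Sum>l\<in>UNIV. u i l * u j l) = (\<Sum>l\<in>UNIV. u i l * u l j)"
      by (intro sum.cong refl) (metis sym)
    ultimately show ?thesis by simp
  qed
  have fus: "fusion z S i j k = complex_of_real (\<Sum>l\<in>UNIV. u i l * u j l * u k l / u z l)" for i j k
    by (simp add: fusion_def Su)
  define n where "n i j = (\<Sum>l\<in>UNIV. u b l * u i l * u j l / u z l)" for i j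
  have nN: "complex_of_real (n i j) \<in> \<nat>" for i j using nat[of b i j] by (simp add: fus n_def)
  have n_nat: "\<exists>c::nat. n i j = real c" for i j
    using nN[of i j] by (metis Nats_cases of_real_eq_iff of_real_of_nat_eq)
  have n0: "0 \<le> n i j" for i j using n_nat[of i j] by auto
  have eig: "(\<Sum>j\<in>UNIV. n i j * u j k) = u i k * u b k / u z k" for i k
  proof -
    have "(\<Sum>j\<in>UNIV. n i j * u j k) = (\<Sum>j\<in>UNIV. \<Sum>l\<in>UNIV. (u b l * u i l / u z l) * (u l j * u k j))"
    proof (rule sum.cong[OF refl])
      fix j
      have "u b l * u i l * u j l / u z l * u j k = (u b l * u i l / u z l) * (u l j * u k j)" for l
        by (simp add: sym[of l j] sym[of k j])
      then show "n i j * u j k = (\<Sum>l\<in>UNIV. (u b l * u i l / u z l) * (u l j * u k j))"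
        by (simp only: n_def sum_distrib_right)
    qed
    also have "\<dots> = (\<Sum>l\<in>UNIV. (u b l * u i l / u z l) * (\<Sum>j\<in>UNIV. u l j * u k j))"
      by (subst sum.swap) (simp add: sum_distrib_left)
    also have "\<dots> = u i k * u b k / u z k"
      by (simp add: orth if_distrib if_distribR cong: if_cong)
    finally show ?thesis .
  qed
  have bound: "\<bar>u b k\<bar> \<le> u z k" for k
  proof -
    define g where "g i = \<bar>u i k\<bar> / u z i" for i
    obtain i where i: "\<And>j. g j \<le> g i"
    proof -
      have "Max (range g) \<in> range g" by (rule Max_in) auto
      then obtain i where "g i = Max (range g)" by (metis imageE)
      then show thesis using that[of i] by simp
    qed
    have "0 < g z" using pos[of k] pos[of z] by (simp add: g_def)
    then have gi: "0 < g i" using i[of z] by linarith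
    have ui: "\<bar>u i k\<bar> = g i * u z i" for i using pos[of i] by (simp add: g_def)
    have "\<bar>u i k\<bar> * \<bar>u b k\<bar> / u z k = \<bar>\<Sum>j\<in>UNIV. n i j * u j k\<bar>"
      using pos[of k] by (simp add: eig abs_mult)
    also have "\<dots> \<le> (\<Sum>j\<in>UNIV. \<bar>n i j * u j k\<bar>)" by (rule sum_abs)
    also have "\<dots> \<le> (\<Sum>j\<in>UNIV. g i * (n i j * u j z))"
    proof (rule sum_mono)
      fix j
      have "\<bar>n i j * u j k\<bar> = n i j * (g j * u z j)" using n0 by (simp add: abs_mult ui)
      also have "\<dots> \<le> n i j * (g i * u z j)"
        using i[of j] pos[of j] n0[of i j] by (intro mult_left_mono mult_right_mono) auto
      finally show "\<bar>n i j * u j k\<bar> \<le> g i * (n i j * u j z)" by (simp add: sym[of z j] algebra_simps)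
    qed
    also have "\<dots> = g i * u z i"
      using pos[of z] zb by (simp add: sum_distrib_left[symmetric] eig sym[of b z] sym[of i z])
    finally have "g i * u z i * (\<bar>u b k\<bar> / u z k) \<le> g i * u z i * 1" by (simp add: ui)
    moreover have "0 < g i * u z i" using gi pos by simp
    ultimately have "\<bar>u b k\<bar> / u z k \<le> 1" by (simp only: mult_le_cancel_left_pos)
    then show ?thesis using pos[of k] by (simp add: divide_le_eq)
  qed
  have sq: "(u b k)\<^sup>2 = (u z k)\<^sup>2" for k
  proof -
    have "(\<Sum>k\<in>UNIV. (u z k)\<^sup>2 - (u b k)\<^sup>2) = 0"
      using orth[of b b] orth[of z z] by (simp add: power2_eq_square sum_subtractf)
    moreover have "0 \<le> (u z k)\<^sup>2 - (u b k)\<^sup>2" for k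
      using bound[of k] by (simp add: abs_le_square_iff[symmetric] pos less_imp_le)
    ultimately show ?thesis by (simp add: sum_nonneg_eq_0_iff)
  qed
  have af: "u i l = 0 \<or> u b l = u z l" if i: "i = e (Lab_a a)" for i l a
  proof -
    have "n i i \<noteq> 0" using fixpt[of a] unfolding i fus n_def of_real_eq_0_iff .
    then have n1: "1 \<le> n i i" using n_nat[of i i] by auto
    have nn: "0 \<le> (u i l)\<^sup>2 - u b l * u i l * u i l / u z l" for l
    proof -
      have "u b l / u z l \<le> 1" using bound[of l] pos[of l] by (simp add: divide_le_eq)
      then have "(u b l / u z l) * (u i l)\<^sup>2 \<le> 1 * (u i l)\<^sup>2" by (intro mult_right_mono) auto
      then show ?thesis by (simp add: power2_eq_square mult.assoc)
    qed
    have "(\<Sum>l\<in>UNIV. (u i l)\<^sup>2 - u b l * u i l * u i l / u z l) = 1 - n i i"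
      using orth[of i i] by (simp add: sum_subtractf n_def power2_eq_square)
    then have "(\<Sum>l\<in>UNIV. (u i l)\<^sup>2 - u b l * u i l * u i l / u z l) = 0"
      using n1 nn by (smt (verit, best) sum_nonneg)
    then have "(u i l)\<^sup>2 - u b l * u i l * u i l / u z l = 0"
      using nn by (simp add: sum_nonneg_eq_0_iff)
    then have "(u i l)\<^sup>2 * (u z l - u b l) = 0"
      using pos[of l] by (simp add: field_simps power2_eq_square)
    then show ?thesis by auto
  qed
  define T' where "T' = map_matrix cnj (transpose T)"
  have TT': "T ** T' = mat 1" using UT by (simp add: unitary_matrix_def T'_def)
  have "S ** T ** S = S ** T ** S ** ((T ** S ** T) ** (T' ** S ** T'))"
  proof -
    have "(T ** S ** T) ** (T' ** S ** T') = T ** S ** (T ** T') ** S ** T'"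
      by (simp add: matrix_mul_assoc)
    also have "\<dots> = T ** (S ** S) ** T'" by (simp add: TT' matrix_mul_assoc)
    finally show ?thesis by (simp add: SS TT')
  qed
  also have "\<dots> = ((S ** T) ** (S ** T) ** (S ** T)) ** (T' ** S ** T')"
    by (simp add: matrix_mul_assoc)
  also have "\<dots> = T' ** S ** T'" by (simp add: SS flip: STcube)
  finally have STS: "S ** T ** S = T' ** S ** T'" .
  have Td: "T $ i $ j = (if i = j then w i else 0)" for i j
    using diag by (auto simp: diagonal_matrix_def w_def)
  have Td': "T' $ i $ j = (if i = j then cnj (w i) else 0)" for i j
    by (simp add: T'_def transpose_def Td)
  have sts: "(\<Sum>k\<in>UNIV. of_real (u i k) * w k * of_real (u k j)) = cnj (w i) * of_real (u i j) * cnj (w j)"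
    for i j
  proof -
    have "(S ** T ** S) $ i $ j = (\<Sum>k\<in>UNIV. of_real (u i k) * w k * of_real (u k j))"
      by (simp add: matrix_matrix_mult_def Td Su if_distrib cong: if_cong)
    moreover have "(T' ** S ** T') $ i $ j = cnj (w i) * of_real (u i j) * cnj (w j)"
      by (simp add: matrix_matrix_mult_def Td' Su if_distrib if_distribR cong: if_cong)
    ultimately show ?thesis using STS by simp
  qed
  have wnorm: "norm (w i) = 1" for i
  proof -
    have "T $ i $ k * T' $ k $ i = (if k = i then w i * cnj (w i) else 0)" for k
      by (simp add: Td Td')
    then have "(T ** T') $ i $ i = w i * cnj (w i)"
      by (simp add: matrix_matrix_mult_def)
    then have "w i * cnj (w i) = 1" by (simp add: TT' mat_def)
    then have "(norm (w i))\<^sup>2 = 1" using complex_mod_mult_cnj[of "w i"] by simp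
    then show ?thesis using norm_ge_zero[of "w i"] by (auto simp add: power2_eq_1_iff simp del: norm_ge_zero)
  qed
  have w0: "w i \<noteq> 0" for i using wnorm[of i] by auto
  have ba: "u b (e (Lab_a a)) = u z (e (Lab_a a))" for a
  proof -
    let ?i = "e (Lab_a a)"
    have "of_real (u b k) * w k * of_real (u k ?i) = of_real (u z k) * w k * of_real (u k ?i)" for k
      using af[OF refl, of a k] by (auto simp: sym[of k])
    then have "cnj (w b) * of_real (u b ?i) * cnj (w ?i) = cnj (w z) * of_real (u z ?i) * cnj (w ?i)"
      by (simp only: sts[symmetric])
    then show ?thesis using w0 by (simp add: wb)
  qed
  have bb: "u b b = u z z"
  proof -
    have "of_real (u b k) * w k * of_real (u k b) = of_real (u z k) * w k * of_real (u k z)" for k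
    proof -
      have "u b k * u b k = u z k * u z k" using sq[of k] by (simp add: power2_eq_square)
      then have "complex_of_real (u b k) * of_real (u b k) = of_real (u z k) * of_real (u z k)"
        by (metis of_real_mult)
      then show ?thesis by (simp add: sym[of k] mult.commute mult.left_commute)
    qed
    then have "cnj (w b) * of_real (u b b) * cnj (w b) = cnj (w z) * of_real (u z z) * cnj (w z)"
      by (simp only: sts[symmetric])
    then show ?thesis using w0 by (simp add: wb)
  qed
  have bd: "u b (e (Lab_d j)) = - u z (e (Lab_d j))" for j
    using sq[of "e (Lab_d j)"] neg[of j] pos[of "e (Lab_d j)"] by (auto simp: power2_eq_iff)
  have ad: "u (e (Lab_a i)) (e (Lab_d j)) = 0" for i j
    using af[OF refl, of i "e (Lab_d j)"] neg[of j] pos[of "e (Lab_d j)"] by auto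
  define a where "a = (\<chi> i. u z (e (Lab_a i)))"
  define d where "d = (\<chi> j. u z (e (Lab_d j)))"
  define A where "A = (\<chi> i j. u (e (Lab_a i)) (e (Lab_a j)))"
  define D where "D = (\<chi> i j. u (e (Lab_d i)) (e (Lab_d j)))"
  have "u (e i) (e j) = block_entry (u z z) (u z z) a d A D i j" for i j
    by (cases i; cases j)
      (simp_all add: a_def d_def A_def D_def e0 zb bb ba bd ad b_def[symmetric]
        sym[of b z] sym[of "e (Lab_a _)" b] sym[of "e (Lab_d _)" b] sym[of "e (Lab_a _)" z]
        sym[of "e (Lab_d _)" z] sym[of "e (Lab_d _)" "e (Lab_a _)"])
  then have "reindex e S = block_S (u z z) (u z z) a d A D"
    by (simp add: vec_eq_iff reindex_def block_S_def Su)
  moreover have "reindex e T = block_T (w z) (\<chi> i. w (e (Lab_a i))) (\<chi> j. w (e (Lab_d j)))"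
    using \<open>bij e\<close> wb
    by (auto simp: vec_eq_iff reindex_def block_T_def Td e0 b_def bij_is_inj inj_eq
        split: lam_index.splits)
  moreover have "\<forall>i. norm ((\<chi> i. w (e (Lab_a i))) $ i) = 1" "\<forall>j. norm ((\<chi> j. w (e (Lab_d j))) $ j) = 1"
    by (simp_all add: wnorm)
  ultimately show ?thesis using wnorm[of z] by blast
qed

end

theory Submission
  imports Defs
begin

text \<open>
  Since \<open>S\<close> is real, modular data amount to a symmetric orthogonal real matrix \<open>u\<close> and a vector
  \<open>w\<close> of twists with \<open>STS = T\<^sup>*ST\<^sup>*\<close> (\<open>pre_modular_data_iff_real_modular\<close>). For a block matrix these
  equations decouple: besides the entries \<open>p\<close>, \<open>q\<close>, the conditions on \<open>(a, A, s)\<close> and those on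
  \<open>(d, D, t)\<close> meet only in the equations at \<open>(0, 0)\<close> and \<open>(0, b)\<close>, through the scalars \<open>\<Sum> a\<^sub>i\<^sup>2\<close>,
  \<open>\<Sum> d\<^sub>j\<^sup>2\<close>, \<open>\<Sum> a\<^sub>i\<^sup>2 s\<^sub>i\<close> and \<open>\<Sum> d\<^sub>j\<^sup>2 t\<^sub>j\<close> (\<open>real_modular_block_iff\<close>). Gluing therefore comes down to comparing
  these scalars. The ten kinds of fusion coefficient that are not determined by the
  vacuum are computed once, for general \<open>p\<close> and \<open>q\<close> (\<open>verlinde_block\<close>).

  The arithmetic rests on the \<open>d\<close>-labels being completely rigid. The coefficient
  \<open>N(b, d\<^sub>j, d\<^sub>j) = 4 d\<^sub>j\<^sup>2 - 1\<close> is a natural number while \<open>\<Sum> d\<^sub>j\<^sup>2 = 1/2\<close>, so \<open>d\<^sub>j\<^sup>2\<close> is \<open>1/4\<close> or \<open>1/2\<close>; the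
  second value makes row \<open>j\<close> of \<open>D\<close> vanish, and then the twist equation at \<open>(d\<^sub>j, d\<^sub>j)\<close> reads \<open>r = 0\<close>.
  Hence \<open>d\<^sub>j = 1/2\<close> for all \<open>j\<close> (\<open>d_half\<close>). Now \<open>N(a\<^sub>i, d\<^sub>j, d\<^sub>j) = a\<^sub>i / (2x)\<close> is a natural number \<open>m\<^sub>i\<close>, and
  the norm of the vacuum row gives \<open>1/(4x\<^sup>2) = 1 + 2 \<Sum> m\<^sub>i\<^sup>2 =: M\<close>, an odd integer. Comparing quantum
  dimensions in the product of \<open>a\<^sub>i\<close> with itself yields \<open>1 + \<Sum>\<^sub>k N(a\<^sub>i, a\<^sub>i, a\<^sub>k) m\<^sub>k = 2 m\<^sub>i\<^sup>2\<close>, so the \<open>m\<^sub>i\<close>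
  have no common divisor. This proves (a), with \<open>L = 1\<close> and \<open>N = M\<close>, and shows that \<open>M\<close> and \<open>L\<close>
  can take no other values (\<open>laminated_integers_unique\<close>).

  In (b) every fusion coefficient comes from one of the two given data, except for
  \<open>N(a\<^sub>i, d'\<^sub>j, d'\<^sub>k) = m\<^sub>i\<close>.

  In (c) put \<open>\<kappa> = 4/(M' - M)\<close>. Every nontrivial fusion coefficient of the glued data is \<open>\<kappa>\<close> times a
  product of the integers \<open>m\<^sub>i\<close>, \<open>m'\<^sub>k\<close>, up to adding or subtracting a Kronecker delta or an old fusion
  coefficient (\<open>V_formula\<close>); the coefficient at \<open>(b, b, b)\<close> is \<open>\<kappa>\<close> itself. So integrality means
  \<open>\<kappa> \<in> \<int>\<close>, and only
  \<open>\<kappa> m'\<^sub>i m'\<^sub>j m'\<^sub>k - N'(a'\<^sub>i, a'\<^sub>j, a'\<^sub>k)\<close> might be negative. The bound \<open>8/(M' - M) = 2\<kappa>\<close> on \<open>N'\<close> prevents this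
  unless \<open>m'\<^sub>i = m'\<^sub>j = m'\<^sub>k = 1\<close>. In that case \<open>N' \<le> 1\<close> by counting the summands of a product of two
  labels with multiplicity (\<open>N_le_1\<close>).
\<close>

section \<open>Real modular data as scalar equations\<close>

text \<open>
  The last equation is \<open>STS = T\<^sup>*ST\<^sup>*\<close>, which for \<open>S\<^sup>2 = 1\<close> is equivalent to \<open>(ST)\<^sup>3 = S\<^sup>2\<close> but quadratic
  in \<open>S\<close> and linear in \<open>T\<close>.
\<close>

definition real_modular :: "'q::finite \<Rightarrow> ('q \<Rightarrow> 'q \<Rightarrow> real) \<Rightarrow> ('q \<Rightarrow> complex) \<Rightarrow> bool" where
  "real_modular z u w \<longleftrightarrow>
     (\<forall>i j. u i j = u j i) \<and> (\<forall>i j. (\<Sum>l\<in>UNIV. u i l * u j l) = (if i = j then 1 else 0)) \<and>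
     (\<forall>l. 0 < u z l) \<and> (\<forall>i. norm (w i) = 1) \<and>
     (\<forall>i j. (\<Sum>l\<in>UNIV. of_real (u i l * u j l) * w l) = cnj (w i) * cnj (w j) * of_real (u i j))"

text \<open>
  Without conjugation in the third factor, the coefficients are visibly symmetric in all three labels.
\<close>

definition verlinde :: "'q::finite \<Rightarrow> ('q \<Rightarrow> 'q \<Rightarrow> real) \<Rightarrow> 'q \<Rightarrow> 'q \<Rightarrow> 'q \<Rightarrow> real" where
  "verlinde z u i j k = (\<Sum>l\<in>UNIV. u i l * u j l * u k l / u z l)"

lemma real_modularD:
  assumes "real_modular z u w"
  shows "u i j = u j i" "(\<Sum>l\<in>UNIV. u i l * u j l) = (if i = j then 1 else 0)" "0 < u z l" "norm (w i) = 1"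
    "(\<Sum>l\<in>UNIV. of_real (u i l * u j l) * w l) = cnj (w i) * cnj (w j) * of_real (u i j)"
  using assms unfolding real_modular_def by blast+

lemma fusion_eq_verlinde:
  assumes "\<And>i j. S $ i $ j = complex_of_real (u i j)"
  shows "fusion z S i j k = of_real (verlinde z u i j k)"
  by (simp add: fusion_def verlinde_def assms)

text \<open>
  Symmetry and realness turn unitarity of \<open>S\<close> into \<open>S\<^sup>2 = 1\<close>, so that charge conjugation is trivial.
  Multiplying \<open>(ST)\<^sup>3 = 1\<close> by \<open>T\<^sup>*ST\<^sup>*\<close> on the right cancels \<open>TST\<close> and leaves the twist equation; the
  converse reverses this.
\<close>

lemma pre_modular_data_iff_real_modular:
  fixes S T :: "complex^'q^'q" and u :: "'q::finite \<Rightarrow> 'q \<Rightarrow> real"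
  assumes S: "\<And>i j. S $ i $ j = of_real (u i j)"
    and T: "\<And>i j. T $ i $ j = (if i = j then w i else 0)"
  shows "pre_modular_data z S T \<and> unitary_real z S \<longleftrightarrow> real_modular z u w"
proof -
  define T' where "T' = map_matrix cnj (transpose T)"
  have T': "T' $ i $ j = (if i = j then cnj (w i) else 0)" for i j
    by (simp add: T'_def transpose_def T)
  have SS: "(S ** S) $ i $ j = of_real (\<Sum>l\<in>UNIV. u i l * u l j)" for i j
    by (simp add: matrix_matrix_mult_def S)
  have STS: "(S ** T ** S) $ i $ j = (\<Sum>l\<in>UNIV. of_real (u i l * u l j) * w l)" for i j
    by (simp add: matrix_matrix_mult_def T S if_distrib mult.commute mult.left_commute cong: if_cong)
  have TST: "(T' ** S ** T') $ i $ j = cnj (w i) * cnj (w j) * of_real (u i j)" for i j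
    by (simp add: matrix_matrix_mult_def T' S if_distrib if_distribR mult.commute mult.left_commute
        cong: if_cong)
  have TT': "(T ** T') $ i $ j = (if i = j then w i * cnj (w i) else 0)" for i j
  proof -
    have "T $ i $ k * T' $ k $ j = (if k = i then if i = j then w i * cnj (w i) else 0 else 0)" for k
      by (simp add: T T')
    then show ?thesis by (simp add: matrix_matrix_mult_def)
  qed
  have T'T: "(T' ** T) $ i $ j = (if i = j then w i * cnj (w i) else 0)" for i j
  proof -
    have "T' $ i $ k * T $ k $ j = (if k = i then if i = j then w i * cnj (w i) else 0 else 0)" for k
      by (simp add: T T' mult.commute)
    then show ?thesis by (simp add: matrix_matrix_mult_def)
  qed
  have w1: "w i * cnj (w i) = 1 \<longleftrightarrow> norm (w i) = 1" for i
  proof -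
    have "w i * cnj (w i) = of_real ((norm (w i))\<^sup>2)"
      using complex_mod_mult_cnj[of "w i"] by (simp add: complex_mult_cnj cmod_power2)
    then have "w i * cnj (w i) = 1 \<longleftrightarrow> (norm (w i))\<^sup>2 = 1"
      by (metis of_real_eq_1_iff)
    then show ?thesis
      using norm_ge_zero[of "w i"] by (auto simp: power2_eq_1_iff simp del: norm_ge_zero)
  qed
  have pos: "unitary_real z S \<longleftrightarrow> (\<forall>l. 0 < u z l)"
    by (auto simp: unitary_real_def S)
  show ?thesis
  proof
    assume *: "pre_modular_data z S T \<and> unitary_real z S"
    then have US: "unitary_matrix S" and UT: "unitary_matrix T" and symS: "transpose S = S"
      and cube: "S ** S = (S ** T) ** (S ** T) ** (S ** T)"
      by (auto simp: pre_modular_data_def)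
    have sym: "u i j = u j i" for i j
    proof -
      have "transpose S $ i $ j = S $ i $ j" by (simp only: symS)
      then show ?thesis by (simp add: transpose_def S)
    qed
    have "map_matrix cnj (transpose S) = S"
      using symS by (simp add: vec_eq_iff S)
    then have S2: "S ** S = mat 1" using US by (simp add: unitary_matrix_def)
    have orth: "(\<Sum>l\<in>UNIV. u i l * u j l) = (if i = j then 1 else 0)" for i j
    proof -
      have "complex_of_real (\<Sum>l\<in>UNIV. u i l * u l j) = of_real (if i = j then 1 else 0)"
        by (simp only: SS[symmetric]) (simp add: S2 mat_def)
      then have "(\<Sum>l\<in>UNIV. u i l * u l j) = (if i = j then 1 else 0)"
        by (simp only: of_real_eq_iff)
      then show ?thesis by (simp add: sym[of _ j])
    qed
    have TT1: "T ** T' = mat 1" using UT by (simp add: unitary_matrix_def T'_def)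
    have "w i * cnj (w i) = 1" for i
      using TT'[of i i] by (simp add: TT1 mat_def)
    then have norm: "norm (w i) = 1" for i using w1 by blast
    have "(T ** S ** T) ** (T' ** S ** T') = T ** S ** (T ** T') ** S ** T'"
      by (simp add: matrix_mul_assoc)
    also have "\<dots> = T ** (S ** S) ** T'" by (simp add: TT1 matrix_mul_assoc)
    finally have "(T ** S ** T) ** (T' ** S ** T') = mat 1" by (simp add: S2 TT1)
    then have "S ** T ** S = S ** T ** S ** ((T ** S ** T) ** (T' ** S ** T'))" by simp
    also have "\<dots> = ((S ** T) ** (S ** T) ** (S ** T)) ** (T' ** S ** T')"
      by (simp add: matrix_mul_assoc)
    also have "\<dots> = T' ** S ** T'" by (simp add: S2 flip: cube)
    finally have sts: "(\<Sum>l\<in>UNIV. of_real (u i l * u l j) * w l) = cnj (w i) * cnj (w j) * of_real (u i j)"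
      for i j by (simp only: STS[symmetric] TST[symmetric])
    have "(\<Sum>l\<in>UNIV. of_real (u i l * u j l) * w l) = cnj (w i) * cnj (w j) * of_real (u i j)"
      for i j
    proof -
      have "complex_of_real (u i l * u j l) * w l = of_real (u i l * u l j) * w l" for l
        by (simp only: sym[of l j])
      then show ?thesis using sts by (simp only:)
    qed
    then show "real_modular z u w"
      using * sym orth norm pos unfolding real_modular_def by blast
  next
    assume R: "real_modular z u w"
    then have sym: "\<And>i j. u i j = u j i"
      and orth: "\<And>i j. (\<Sum>l\<in>UNIV. u i l * u j l) = (if i = j then 1 else 0)"
      and gt: "\<And>l. 0 < u z l" and norm: "\<And>i. norm (w i) = 1"
      and tw: "\<And>i j. (\<Sum>l\<in>UNIV. of_real (u i l * u j l) * w l) = cnj (w i) * cnj (w j) * of_real (u i j)"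
      unfolding real_modular_def by blast+
    have S2: "S ** S = mat 1"
    proof -
      have "(S ** S) $ i $ j = mat 1 $ i $ j" for i j
        unfolding SS by (subst sym[of _ j]) (simp only: orth, simp add: mat_def)
      then show ?thesis by (simp add: vec_eq_iff)
    qed
    have TT1: "T ** T' = mat 1" "T' ** T = mat 1"
      using norm w1 by (simp_all add: vec_eq_iff TT' T'T mat_def)
    have "(S ** T ** S) $ i $ j = (T' ** S ** T') $ i $ j" for i j
      unfolding STS TST by (subst sym[of _ j]) (rule tw)
    then have STS': "S ** T ** S = T' ** S ** T'" by (simp add: vec_eq_iff)
    have "(S ** T) ** (S ** T) ** (S ** T) = (S ** T ** S) ** (T ** S ** T)"
      by (simp add: matrix_mul_assoc)
    also have "\<dots> = T' ** S ** (T' ** T) ** S ** T"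
      by (simp only: STS' matrix_mul_assoc)
    also have "\<dots> = T' ** (S ** S) ** T"
      by (simp only: TT1 matrix_mul_rid matrix_mul_assoc)
    finally have cube: "(S ** T) ** (S ** T) ** (S ** T) = mat 1" by (simp add: S2 TT1)
    have tr: "transpose S = S" by (simp add: vec_eq_iff transpose_def S) (metis sym)
    have cS: "map_matrix cnj (transpose S) = S" by (simp add: tr) (simp add: vec_eq_iff S)
    have "permutation_matrix (S ** S)"
      unfolding permutation_matrix_def by (rule exI[of _ id]) (auto simp: S2 mat_def)
    moreover have "unitary_matrix S" by (simp add: unitary_matrix_def cS S2)
    moreover have "unitary_matrix T"
      using TT1 by (simp add: unitary_matrix_def T'_def)
    moreover have "diagonal_matrix T" by (simp add: diagonal_matrix_def T)
    moreover have "S $ z $ l \<in> \<real> \<and> S $ z $ l \<noteq> 0" for l using gt[of l] by (simp add: S)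
    ultimately show "pre_modular_data z S T \<and> unitary_real z S"
      using gt pos tr unfolding pre_modular_data_def cube by (simp add: S2)
  qed
qed

lemma real_modular_reindex:
  assumes R: "real_modular (e z) u w" and e: "bij e"
  shows "real_modular z (\<lambda>i j. u (e i) (e j)) (\<lambda>i. w (e i))"
proof -
  have "(\<Sum>l\<in>UNIV. u (e i) (e l) * u (e j) (e l)) = (\<Sum>l\<in>UNIV. u (e i) l * u (e j) l)" for i j
    by (rule sum.reindex_bij_betw[OF e])
  moreover have "(\<Sum>l\<in>UNIV. complex_of_real (u (e i) (e l) * u (e j) (e l)) * w (e l))
      = (\<Sum>l\<in>UNIV. of_real (u (e i) l * u (e j) l) * w l)" for i j
    by (rule sum.reindex_bij_betw[OF e])
  ultimately show ?thesis
    unfolding real_modular_def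
    by (simp only: real_modularD(2-)[OF R] inj_eq[OF bij_is_inj[OF e]])
       (simp add: real_modularD(1)[OF R])
qed

lemma verlinde_reindex:
  assumes "bij e"
  shows "verlinde (e z) u (e i) (e j) (e k) = verlinde z (\<lambda>i j. u (e i) (e j)) i j k"
  unfolding verlinde_def by (rule sum.reindex_bij_betw[OF assms, symmetric])

lemma verlinde_swap12: "verlinde z u i j k = verlinde z u j i k"
  by (simp add: verlinde_def mult.commute)

lemma verlinde_swap23: "verlinde z u i j k = verlinde z u i k j"
  by (simp add: verlinde_def mult.commute mult.left_commute)

lemma verlinde_rotate: "verlinde z u i j k = verlinde z u k i j"
  by (simp add: verlinde_def mult.commute mult.left_commute)

lemma verlinde_vacuum:
  assumes "real_modular z u w"
  shows "verlinde z u z j k = (if j = k then 1 else 0)"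
proof -
  have "u z l \<noteq> 0" for l using assms by (metis real_modular_def less_irrefl)
  then have "verlinde z u z j k = (\<Sum>l\<in>UNIV. u j l * u k l)" by (simp add: verlinde_def)
  then show ?thesis by (simp only: real_modularD(2)[OF assms])
qed

text \<open>
  The quantum dimensions \<open>u z i / u z z\<close> form a character of the fusion ring.
\<close>

lemma sum_verlinde_dim:
  assumes R: "real_modular z u w"
  shows "(\<Sum>k\<in>UNIV. verlinde z u i j k * u z k) = u z i * u z j / u z z"
proof -
  note sym = real_modularD(1)[OF R] and orth = real_modularD(2)[OF R]
  have "(\<Sum>k\<in>UNIV. verlinde z u i j k * u z k)
      = (\<Sum>k\<in>UNIV. \<Sum>l\<in>UNIV. u i l * u j l / u z l * (u l k * u z k))"
    by (simp add: verlinde_def sum_distrib_right sym mult.assoc)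
  also have "\<dots> = (\<Sum>l\<in>UNIV. u i l * u j l / u z l * (\<Sum>k\<in>UNIV. u l k * u z k))"
    by (subst sum.swap) (simp add: sum_distrib_left)
  also have "\<dots> = u z i * u z j / u z z"
    by (simp add: orth if_distrib if_distribR sym[of i z] sym[of j z] cong: if_cong)
  finally show ?thesis .
qed

text \<open>
  The right-hand side is symmetric in all four labels; this is associativity of the fusion product, in
  the form of the number of copies of the vacuum in a fourfold product.
\<close>

lemma sum_verlinde_verlinde:
  assumes R: "real_modular z u w"
  shows "(\<Sum>l\<in>UNIV. verlinde z u i j l * verlinde z u i' j' l)
    = (\<Sum>k\<in>UNIV. u i k * u j k * u i' k * u j' k / (u z k)\<^sup>2)"
proof -
  note sym = real_modularD(1)[OF R] and orth = real_modularD(2)[OF R]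
  define f where "f k = u i k * u j k / u z k" for k
  define g where "g k = u i' k * u j' k / u z k" for k
  have "(\<Sum>l\<in>UNIV. verlinde z u i j l * verlinde z u i' j' l)
      = (\<Sum>l\<in>UNIV. (\<Sum>k\<in>UNIV. f k * u k l) * (\<Sum>k'\<in>UNIV. g k' * u k' l))"
    by (intro sum.cong refl) (simp add: verlinde_def f_def g_def sym)
  also have "\<dots> = (\<Sum>l\<in>UNIV. \<Sum>k\<in>UNIV. \<Sum>k'\<in>UNIV. f k * g k' * (u k l * u k' l))"
    by (simp add: sum_product mult.assoc mult.left_commute)
  also have "\<dots> = (\<Sum>k\<in>UNIV. \<Sum>k'\<in>UNIV. \<Sum>l\<in>UNIV. f k * g k' * (u k l * u k' l))"
    by (subst sum.swap) (intro sum.cong refl sum.swap)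
  also have "\<dots> = (\<Sum>k\<in>UNIV. \<Sum>k'\<in>UNIV. f k * g k' * (\<Sum>l\<in>UNIV. u k l * u k' l))"
    by (simp add: sum_distrib_left)
  also have "\<dots> = (\<Sum>k\<in>UNIV. f k * g k)"
    by (simp add: orth if_distrib if_distribR cong: if_cong)
  finally show ?thesis by (simp add: f_def g_def power2_eq_square mult.assoc)
qed

section \<open>Block matrices\<close>

lemma sum_lam_index:
  fixes f :: "('m::finite, 'n::finite) lam_index \<Rightarrow> 'a::comm_monoid_add"
  shows "(\<Sum>l\<in>UNIV. f l) = f Lab_0 + f Lab_b + (\<Sum>i\<in>UNIV. f (Lab_a i)) + (\<Sum>j\<in>UNIV. f (Lab_d j))"
proof -
  have "(\<Sum>l\<in>UNIV. f l) = (\<Sum>l\<in>{Lab_0, Lab_b}. f l) + sum f (range Lab_a) + sum f (range Lab_d)"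
    unfolding UNIV_lam_index
    by (subst sum.union_disjoint; (subst sum.union_disjoint)?) auto
  then show ?thesis by (simp add: sum.reindex inj_on_def add.assoc)
qed

definition block_twist :: "complex \<Rightarrow> complex^'m \<Rightarrow> complex^'n \<Rightarrow> ('m, 'n) lam_index \<Rightarrow> complex" where
  "block_twist r s t l = (case l of Lab_0 \<Rightarrow> r | Lab_b \<Rightarrow> r | Lab_a k \<Rightarrow> s $ k | Lab_d k \<Rightarrow> t $ k)"

lemma block_twist_simps [simp]:
  "block_twist r s t Lab_0 = r" "block_twist r s t Lab_b = r"
  "block_twist r s t (Lab_a k) = s $ k" "block_twist r s t (Lab_d l) = t $ l"
  by (simp_all add: block_twist_def)

lemma all_lam_index: "(\<forall>l. P l) \<longleftrightarrow> P Lab_0 \<and> P Lab_b \<and> (\<forall>i. P (Lab_a i)) \<and> (\<forall>j. P (Lab_d j))"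
  by (metis lam_index.exhaust)

text \<open>
  In block form, the rows of \<open>0\<close> and \<open>b\<close> differ only by exchanging \<open>p\<close> with \<open>q\<close> and by a sign on the
  \<open>d\<close>-labels. Both sides of the orthogonality and twist equations inherit this, which leaves six of the
  sixteen kinds of entry to compare.
\<close>

lemma block_pairs:
  fixes G V :: "('m, 'n) lam_index \<Rightarrow> ('m, 'n) lam_index \<Rightarrow> 'k::group_add"
  assumes "\<And>i j. G i j = G j i" "G Lab_b Lab_b = G Lab_0 Lab_0"
    "\<And>i. G Lab_b (Lab_a i) = G Lab_0 (Lab_a i)" "\<And>j. G Lab_b (Lab_d j) = - G Lab_0 (Lab_d j)"
    "\<And>i j. G (Lab_a i) (Lab_d j) = 0"
    and "\<And>i j. V i j = V j i" "V Lab_b Lab_b = V Lab_0 Lab_0"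
    "\<And>i. V Lab_b (Lab_a i) = V Lab_0 (Lab_a i)" "\<And>j. V Lab_b (Lab_d j) = - V Lab_0 (Lab_d j)"
    "\<And>i j. V (Lab_a i) (Lab_d j) = 0"
  shows "(\<forall>i j. G i j = V i j) \<longleftrightarrow>
    G Lab_0 Lab_0 = V Lab_0 Lab_0 \<and> G Lab_0 Lab_b = V Lab_0 Lab_b \<and>
    (\<forall>i. G Lab_0 (Lab_a i) = V Lab_0 (Lab_a i)) \<and> (\<forall>j. G Lab_0 (Lab_d j) = V Lab_0 (Lab_d j)) \<and>
    (\<forall>i j. G (Lab_a i) (Lab_a j) = V (Lab_a i) (Lab_a j)) \<and>
    (\<forall>i j. G (Lab_d i) (Lab_d j) = V (Lab_d i) (Lab_d j))" (is "?L \<longleftrightarrow> ?R")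
proof
  assume R: ?R
  have "G i j = V i j" for i j
  proof (cases i; cases j)
  qed (use R assms(2-5) assms(7-10) in \<open>simp_all add: assms(1)[of Lab_b Lab_0] assms(1)[of "Lab_a _" Lab_0]
      assms(1)[of "Lab_a _" Lab_b] assms(1)[of "Lab_d _" Lab_0] assms(1)[of "Lab_d _" Lab_b]
      assms(1)[of "Lab_d _" "Lab_a _"] assms(6)[of Lab_b Lab_0] assms(6)[of "Lab_a _" Lab_0]
      assms(6)[of "Lab_a _" Lab_b] assms(6)[of "Lab_d _" Lab_0] assms(6)[of "Lab_d _" Lab_b]
      assms(6)[of "Lab_d _" "Lab_a _"]\<close>)
  then show ?L by blast
qed blast

text \<open>
  The weight \<open>w\<close> is constant \<open>1\<close> for the orthogonality relations and the twist for the relation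
  \<open>STS = T\<^sup>*ST\<^sup>*\<close>.
\<close>

lemma block_gram:
  fixes p q :: real and A D and a :: "real^'m::finite" and d :: "real^'n::finite" and w :: "('m, 'n) lam_index \<Rightarrow> 'k::real_field"
  defines "G \<equiv> \<lambda>i j. \<Sum>l\<in>UNIV. of_real (block_entry p q a d A D i l * block_entry p q a d A D j l) * w l"
  assumes w: "w Lab_b = w Lab_0"
  shows "G i j = G j i" "G Lab_b Lab_b = G Lab_0 Lab_0"
    "G Lab_b (Lab_a k) = G Lab_0 (Lab_a k)" "G Lab_b (Lab_d l) = - G Lab_0 (Lab_d l)"
    "G (Lab_a k) (Lab_d l) = 0"
    "G Lab_0 Lab_0 = of_real (p\<^sup>2 + q\<^sup>2) * w Lab_0 + (\<Sum>i\<in>UNIV. of_real ((a $ i)\<^sup>2) * w (Lab_a i))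
       + (\<Sum>j\<in>UNIV. of_real ((d $ j)\<^sup>2) * w (Lab_d j))"
    "G Lab_0 Lab_b = of_real (2 * p * q) * w Lab_0 + (\<Sum>i\<in>UNIV. of_real ((a $ i)\<^sup>2) * w (Lab_a i))
       - (\<Sum>j\<in>UNIV. of_real ((d $ j)\<^sup>2) * w (Lab_d j))"
    "G Lab_0 (Lab_a k) = of_real ((p + q) * a $ k) * w Lab_0
       + (\<Sum>i\<in>UNIV. of_real (a $ i * A $ k $ i) * w (Lab_a i))"
    "G Lab_0 (Lab_d l) = of_real ((p - q) * d $ l) * w Lab_0
       + (\<Sum>j\<in>UNIV. of_real (d $ j * D $ l $ j) * w (Lab_d j))"
    "G (Lab_a k) (Lab_a k') = of_real (2 * a $ k * a $ k') * w Lab_0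
       + (\<Sum>i\<in>UNIV. of_real (A $ k $ i * A $ k' $ i) * w (Lab_a i))"
    "G (Lab_d l) (Lab_d l') = of_real (2 * d $ l * d $ l') * w Lab_0
       + (\<Sum>j\<in>UNIV. of_real (D $ l $ j * D $ l' $ j) * w (Lab_d j))"
proof -
  show "G i j = G j i" by (simp add: G_def mult.commute mult.left_commute)
qed (simp_all add: G_def sum_lam_index w sum_negf power2_eq_square distrib_left distrib_right
      left_diff_distrib right_diff_distrib mult.commute mult.left_commute add.assoc)

text \<open>
  The equations for \<open>(a, A, s)\<close> and \<open>(d, D, t)\<close> are separate, except for the two norms and the two
  Gauss sums, where only the sum and the difference of the contributions of both blocks are prescribed.
\<close>

lemma real_modular_block_iff:
  fixes p q :: real and A D and a :: "real^'m::finite" and d :: "real^'n::finite" and r :: complex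
  shows "real_modular Lab_0 (block_entry p q a d A D) (block_twist r s t) \<longleftrightarrow>
    (0 < p \<and> 0 < q \<and> (\<forall>i. 0 < a $ i) \<and> (\<forall>j. 0 < d $ j)) \<and>
    (norm r = 1 \<and> (\<forall>i. norm (s $ i) = 1) \<and> (\<forall>j. norm (t $ j) = 1)) \<and>
    ((\<forall>i j. A $ i $ j = A $ j $ i) \<and> (\<forall>i j. D $ i $ j = D $ j $ i)) \<and>
    (p\<^sup>2 + q\<^sup>2 + (\<Sum>l\<in>UNIV. (a $ l)\<^sup>2) + (\<Sum>l\<in>UNIV. (d $ l)\<^sup>2) = 1 \<and>
     2 * p * q + (\<Sum>l\<in>UNIV. (a $ l)\<^sup>2) - (\<Sum>l\<in>UNIV. (d $ l)\<^sup>2) = 0 \<and>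
     (\<forall>i. (p + q) * a $ i + (\<Sum>l\<in>UNIV. a $ l * A $ i $ l) = 0) \<and>
     (\<forall>j. (p - q) * d $ j + (\<Sum>l\<in>UNIV. d $ l * D $ j $ l) = 0) \<and>
     (\<forall>i j. 2 * a $ i * a $ j + (\<Sum>l\<in>UNIV. A $ i $ l * A $ j $ l) = (if i = j then 1 else 0)) \<and>
     (\<forall>i j. 2 * d $ i * d $ j + (\<Sum>l\<in>UNIV. D $ i $ l * D $ j $ l) = (if i = j then 1 else 0))) \<and>
    (of_real (p\<^sup>2 + q\<^sup>2) * r + (\<Sum>l\<in>UNIV. of_real ((a $ l)\<^sup>2) * s $ l) + (\<Sum>l\<in>UNIV. of_real ((d $ l)\<^sup>2) * t $ l)
       = cnj r * cnj r * of_real p \<and>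
     of_real (2 * p * q) * r + (\<Sum>l\<in>UNIV. of_real ((a $ l)\<^sup>2) * s $ l) - (\<Sum>l\<in>UNIV. of_real ((d $ l)\<^sup>2) * t $ l)
       = cnj r * cnj r * of_real q \<and>
     (\<forall>i. of_real ((p + q) * a $ i) * r + (\<Sum>l\<in>UNIV. of_real (a $ l * A $ i $ l) * s $ l)
       = cnj r * cnj (s $ i) * of_real (a $ i)) \<and>
     (\<forall>j. of_real ((p - q) * d $ j) * r + (\<Sum>l\<in>UNIV. of_real (d $ l * D $ j $ l) * t $ l)
       = cnj r * cnj (t $ j) * of_real (d $ j)) \<and>
     (\<forall>i j. of_real (2 * a $ i * a $ j) * r + (\<Sum>l\<in>UNIV. of_real (A $ i $ l * A $ j $ l) * s $ l)
       = cnj (s $ i) * cnj (s $ j) * of_real (A $ i $ j)) \<and>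
     (\<forall>i j. of_real (2 * d $ i * d $ j) * r + (\<Sum>l\<in>UNIV. of_real (D $ i $ l * D $ j $ l) * t $ l)
       = cnj (t $ i) * cnj (t $ j) * of_real (D $ i $ j)))"
    (is "_ \<longleftrightarrow> ?pos \<and> ?norm \<and> ?sym \<and> ?orth \<and> ?twist")
proof -
  let ?u = "block_entry p q a d A D" and ?w = "block_twist r s t"
  \<comment> \<open>The symmetry of the block matrix is needed to reduce the twist equations to six kinds.\<close>
  have shuffle: "(S \<and> O' \<and> P \<and> N \<and> Q) = (P \<and> N \<and> S \<and> O' \<and> Q')" if "S \<Longrightarrow> Q = Q'" for S O' P N Q Q'
    using that by blast
  have pos: "(\<forall>l. 0 < ?u Lab_0 l) \<longleftrightarrow> ?pos" by (simp add: all_lam_index)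
  have norm: "(\<forall>l. norm (?w l) = 1) \<longleftrightarrow> ?norm" by (simp add: all_lam_index)
  have sym: "(\<forall>i j. ?u i j = ?u j i) \<longleftrightarrow> ?sym" by (simp add: all_lam_index)
  have orth: "(\<forall>i j. (\<Sum>l\<in>UNIV. ?u i l * ?u j l) = (if i = j then 1 else 0)) \<longleftrightarrow> ?orth"
  proof -
    note gram = block_gram[of "\<lambda>_. 1::real" p q a d A D, OF refl, unfolded of_real_eq_id id_apply mult_1_right]
    show ?thesis
      by (subst block_pairs, (rule gram(1-5))+, rule if_cong, rule eq_commute, rule refl, rule refl,
          simp_all only: gram(6-)) simp_all
  qed
  have twist: "(\<forall>i j. (\<Sum>l\<in>UNIV. of_real (?u i l * ?u j l) * ?w l) = cnj (?w i) * cnj (?w j) * of_real (?u i j)) \<longleftrightarrow> ?twist"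
    if ?sym
  proof -
    have w: "?w Lab_b = ?w Lab_0" by simp
    note gram = block_gram[of ?w p q a d A D, OF w]
    have "?u i j = ?u j i" for i j using that sym by blast
    then have V: "cnj (?w i) * cnj (?w j) * of_real (?u i j) = cnj (?w j) * cnj (?w i) * of_real (?u j i)" for i j
      by (metis mult.commute)
    show ?thesis
      by (subst block_pairs, (rule gram(1-5))+, rule V,
          simp_all only: gram(6-) block_twist_simps block_entry.simps) simp_all
  qed
  show ?thesis unfolding real_modular_def pos norm sym orth by (rule shuffle[OF twist])
qed

text \<open>
  On the labels of type \<open>a\<close> and \<open>d\<close> the rows of \<open>0\<close> and \<open>b\<close> agree up to sign, so that a factor from row
  \<open>b\<close> cancels the denominator there, and the rows of labels of different type have disjoint supports.
  The sums that remain are those of the orthogonality relations, except for three labels of the same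
  type.
\<close>

lemma verlinde_block:
  fixes p q :: real and A D and a :: "real^'m::finite" and d :: "real^'n::finite"
  assumes "0 < p" "0 < q" and a: "\<And>i. 0 < a $ i" and d: "\<And>j. 0 < d $ j"
  defines "N \<equiv> verlinde Lab_0 (block_entry p q a d A D)"
  shows "N Lab_b Lab_b Lab_b = q ^ 3 / p + p ^ 3 / q + (\<Sum>l\<in>UNIV. (a $ l)\<^sup>2) - (\<Sum>l\<in>UNIV. (d $ l)\<^sup>2)"
    "N Lab_b Lab_b (Lab_a i) = q\<^sup>2 * a $ i / p + p\<^sup>2 * a $ i / q + (\<Sum>l\<in>UNIV. a $ l * A $ i $ l)"
    "N Lab_b Lab_b (Lab_d j) = q\<^sup>2 * d $ j / p - p\<^sup>2 * d $ j / q + (\<Sum>l\<in>UNIV. d $ l * D $ j $ l)"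
    "N Lab_b (Lab_a i) (Lab_a i') = q * a $ i * a $ i' / p + p * a $ i * a $ i' / q + (\<Sum>l\<in>UNIV. A $ i $ l * A $ i' $ l)"
    "N Lab_b (Lab_a i) (Lab_d j) = q * a $ i * d $ j / p - p * a $ i * d $ j / q"
    "N Lab_b (Lab_d j) (Lab_d j') = q * d $ j * d $ j' / p + p * d $ j * d $ j' / q - (\<Sum>l\<in>UNIV. D $ j $ l * D $ j' $ l)"
    "N (Lab_a i) (Lab_a i') (Lab_a i'') = a $ i * a $ i' * a $ i'' * (1 / p + 1 / q)
       + (\<Sum>l\<in>UNIV. A $ i $ l * A $ i' $ l * A $ i'' $ l / a $ l)"
    "N (Lab_a i) (Lab_a i') (Lab_d j) = a $ i * a $ i' * d $ j * (1 / p - 1 / q)"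
    "N (Lab_a i) (Lab_d j) (Lab_d j') = a $ i * d $ j * d $ j' * (1 / p + 1 / q)"
    "N (Lab_d j) (Lab_d j') (Lab_d j'') = d $ j * d $ j' * d $ j'' * (1 / p - 1 / q)
       + (\<Sum>l\<in>UNIV. D $ j $ l * D $ j' $ l * D $ j'' $ l / d $ l)"
proof -
  have [simp]: "a $ i \<noteq> 0" "d $ j \<noteq> 0" for i j using a[of i] d[of j] by simp_all
  note s = N_def verlinde_def sum_lam_index sum_negf power2_eq_square power3_eq_cube mult.assoc
  show "N Lab_b Lab_b Lab_b = q ^ 3 / p + p ^ 3 / q + (\<Sum>l\<in>UNIV. (a $ l)\<^sup>2) - (\<Sum>l\<in>UNIV. (d $ l)\<^sup>2)"
    by (simp add: s)
  show "N Lab_b Lab_b (Lab_a i) = q\<^sup>2 * a $ i / p + p\<^sup>2 * a $ i / q + (\<Sum>l\<in>UNIV. a $ l * A $ i $ l)"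
    by (simp add: s)
  show "N Lab_b Lab_b (Lab_d j) = q\<^sup>2 * d $ j / p - p\<^sup>2 * d $ j / q + (\<Sum>l\<in>UNIV. d $ l * D $ j $ l)"
    by (simp add: s)
  show "N Lab_b (Lab_a i) (Lab_a i') = q * a $ i * a $ i' / p + p * a $ i * a $ i' / q + (\<Sum>l\<in>UNIV. A $ i $ l * A $ i' $ l)"
    by (simp add: s)
  show "N Lab_b (Lab_a i) (Lab_d j) = q * a $ i * d $ j / p - p * a $ i * d $ j / q"
    by (simp add: s)
  show "N Lab_b (Lab_d j) (Lab_d j') = q * d $ j * d $ j' / p + p * d $ j * d $ j' / q - (\<Sum>l\<in>UNIV. D $ j $ l * D $ j' $ l)"
    by (simp add: s)
  show "N (Lab_a i) (Lab_a i') (Lab_a i'') = a $ i * a $ i' * a $ i'' * (1 / p + 1 / q)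
       + (\<Sum>l\<in>UNIV. A $ i $ l * A $ i' $ l * A $ i'' $ l / a $ l)"
    by (simp add: s distrib_left right_diff_distrib)
  show "N (Lab_a i) (Lab_a i') (Lab_d j) = a $ i * a $ i' * d $ j * (1 / p - 1 / q)"
    by (simp add: s distrib_left right_diff_distrib)
  show "N (Lab_a i) (Lab_d j) (Lab_d j') = a $ i * d $ j * d $ j' * (1 / p + 1 / q)"
    by (simp add: s distrib_left right_diff_distrib)
  show "N (Lab_d j) (Lab_d j') (Lab_d j'') = d $ j * d $ j' * d $ j'' * (1 / p - 1 / q)
       + (\<Sum>l\<in>UNIV. D $ j $ l * D $ j' $ l * D $ j'' $ l / d $ l)"
    by (simp add: s distrib_left right_diff_distrib)
qed

text \<open>
  By symmetry and because \<open>0\<close> is the unit of the fusion ring, these ten kinds of coefficient decide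
  membership in any set containing \<open>0\<close> and \<open>1\<close>; it is used for the naturals, the integers and the
  nonnegative reals.
\<close>

lemma verlinde_block_in:
  fixes p q :: real and A D and a :: "real^'m::finite" and d :: "real^'n::finite"
  assumes R: "real_modular Lab_0 (block_entry p q a d A D) w"
  defines "N \<equiv> verlinde Lab_0 (block_entry p q a d A D)"
  assumes "0 \<in> X" "1 \<in> X"
    and "N Lab_b Lab_b Lab_b \<in> X" "\<And>i. N Lab_b Lab_b (Lab_a i) \<in> X" "\<And>j. N Lab_b Lab_b (Lab_d j) \<in> X"
    "\<And>i i'. N Lab_b (Lab_a i) (Lab_a i') \<in> X" "\<And>i j. N Lab_b (Lab_a i) (Lab_d j) \<in> X"
    "\<And>j j'. N Lab_b (Lab_d j) (Lab_d j') \<in> X" "\<And>i i' i''. N (Lab_a i) (Lab_a i') (Lab_a i'') \<in> X"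
    "\<And>i i' j. N (Lab_a i) (Lab_a i') (Lab_d j) \<in> X" "\<And>i j j'. N (Lab_a i) (Lab_d j) (Lab_d j') \<in> X"
    "\<And>j j' j''. N (Lab_d j) (Lab_d j') (Lab_d j'') \<in> X"
  shows "N i j k \<in> X"
proof -
  have s12: "N i j k = N j i k" and s23: "N i j k = N i k j" for i j k
    unfolding N_def by (rule verlinde_swap12, rule verlinde_swap23)
  have N0: "N Lab_0 j k \<in> X" for j k
    using verlinde_vacuum[OF R] assms by (simp add: N_def)
  show ?thesis
    by (cases i; cases j; cases k; hypsubst) (metis N0 assms(5-) s12 s23)+
qed

section \<open>Arithmetic of laminated data\<close>

locale laminated_block =
  fixes x :: real and r :: complex and a :: "real^'m::finite" and d :: "real^'n::finite"
    and A :: "real^'m^'m" and D :: "real^'n^'n" and s :: "complex^'m" and t :: "complex^'n"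
  assumes R: "real_modular Lab_0 (block_entry x x a d A D) (block_twist r s t)"
    and nat: "\<And>i j k. verlinde Lab_0 (block_entry x x a d A D) i j k \<in> \<nat>"
begin

abbreviation "N \<equiv> verlinde Lab_0 (block_entry x x a d A D)"

lemmas eqs = real_modular_block_iff[THEN iffD1, OF R]

lemma pos: "0 < x" "0 < a $ i" "0 < d $ j"
  using eqs by blast+

lemma norms: "norm r = 1" "norm (s $ i) = 1" "norm (t $ j) = 1"
  using eqs by blast+

lemma sym: "A $ i $ i' = A $ i' $ i" "D $ j $ j' = D $ j' $ j"
  using eqs by blast+

lemma orth:
  "2 * x\<^sup>2 + (\<Sum>l\<in>UNIV. (a $ l)\<^sup>2) = 1 / 2" "(\<Sum>l\<in>UNIV. (d $ l)\<^sup>2) = 1 / 2"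
  "(\<Sum>l\<in>UNIV. a $ l * A $ i $ l) = - 2 * x * a $ i" "(\<Sum>l\<in>UNIV. d $ l * D $ j $ l) = 0"
  "(\<Sum>l\<in>UNIV. A $ i $ l * A $ i' $ l) = (if i = i' then 1 else 0) - 2 * a $ i * a $ i'"
  "(\<Sum>l\<in>UNIV. D $ j $ l * D $ j' $ l) = (if j = j' then 1 else 0) - 2 * d $ j * d $ j'"
proof -
  have o: "x\<^sup>2 + x\<^sup>2 + (\<Sum>l\<in>UNIV. (a $ l)\<^sup>2) + (\<Sum>l\<in>UNIV. (d $ l)\<^sup>2) = 1"
    "2 * x * x + (\<Sum>l\<in>UNIV. (a $ l)\<^sup>2) - (\<Sum>l\<in>UNIV. (d $ l)\<^sup>2) = 0"
    "(x + x) * a $ i + (\<Sum>l\<in>UNIV. a $ l * A $ i $ l) = 0"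
    "(x - x) * d $ j + (\<Sum>l\<in>UNIV. d $ l * D $ j $ l) = 0"
    "2 * a $ i * a $ i' + (\<Sum>l\<in>UNIV. A $ i $ l * A $ i' $ l) = (if i = i' then 1 else 0)"
    "2 * d $ j * d $ j' + (\<Sum>l\<in>UNIV. D $ j $ l * D $ j' $ l) = (if j = j' then 1 else 0)"
    using eqs by blast+
  from o(1,2) show "2 * x\<^sup>2 + (\<Sum>l\<in>UNIV. (a $ l)\<^sup>2) = 1 / 2" "(\<Sum>l\<in>UNIV. (d $ l)\<^sup>2) = 1 / 2"
    by (simp_all add: power2_eq_square)
  from o(3) show "(\<Sum>l\<in>UNIV. a $ l * A $ i $ l) = - 2 * x * a $ i" by (simp add: algebra_simps)
  from o(4) show "(\<Sum>l\<in>UNIV. d $ l * D $ j $ l) = 0" by simp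
  from o(5) show "(\<Sum>l\<in>UNIV. A $ i $ l * A $ i' $ l) = (if i = i' then 1 else 0) - 2 * a $ i * a $ i'" by linarith
  from o(6) show "(\<Sum>l\<in>UNIV. D $ j $ l * D $ j' $ l) = (if j = j' then 1 else 0) - 2 * d $ j * d $ j'" by linarith
qed

lemma twist:
  "of_real (2 * x\<^sup>2) * r + (\<Sum>l\<in>UNIV. of_real ((a $ l)\<^sup>2) * s $ l) = cnj r * cnj r * of_real x"
  "(\<Sum>l\<in>UNIV. of_real ((d $ l)\<^sup>2) * t $ l) = 0"
  "of_real (2 * x * a $ i) * r + (\<Sum>l\<in>UNIV. of_real (a $ l * A $ i $ l) * s $ l)
     = cnj r * cnj (s $ i) * of_real (a $ i)"
  "(\<Sum>l\<in>UNIV. of_real (d $ l * D $ j $ l) * t $ l) = cnj r * cnj (t $ j) * of_real (d $ j)"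
  "of_real (2 * a $ i * a $ i') * r + (\<Sum>l\<in>UNIV. of_real (A $ i $ l * A $ i' $ l) * s $ l)
     = cnj (s $ i) * cnj (s $ i') * of_real (A $ i $ i')"
  "of_real (2 * d $ j * d $ j') * r + (\<Sum>l\<in>UNIV. of_real (D $ j $ l * D $ j' $ l) * t $ l)
     = cnj (t $ j) * cnj (t $ j') * of_real (D $ j $ j')"
proof -
  let ?p = "(\<Sum>l\<in>UNIV. complex_of_real ((a $ l)\<^sup>2) * s $ l)"
    and ?m = "(\<Sum>l\<in>UNIV. complex_of_real ((d $ l)\<^sup>2) * t $ l)"
  have o: "of_real (x\<^sup>2 + x\<^sup>2) * r + ?p + ?m = cnj r * cnj r * of_real x"
    "of_real (2 * x * x) * r + ?p - ?m = cnj r * cnj r * of_real x"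
    "of_real ((x + x) * a $ i) * r + (\<Sum>l\<in>UNIV. of_real (a $ l * A $ i $ l) * s $ l)
       = cnj r * cnj (s $ i) * of_real (a $ i)"
    "of_real ((x - x) * d $ j) * r + (\<Sum>l\<in>UNIV. of_real (d $ l * D $ j $ l) * t $ l)
       = cnj r * cnj (t $ j) * of_real (d $ j)"
    using eqs by blast+
  have eq: "x\<^sup>2 + x\<^sup>2 = 2 * x\<^sup>2" "2 * x * x = 2 * x\<^sup>2" "(x + x) * a $ i = 2 * x * a $ i" "(x - x) * d $ j = 0"
    by (simp_all add: power2_eq_square)
  note o = o[unfolded eq]
  have "2 * m = 0" if "u + v + m = c" "u + v - m = c" for u v m c :: complex
  proof -
    have "2 * m = (u + v + m) - (u + v - m)" by simp
    then show ?thesis using that by simp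
  qed
  from this[OF o(1,2)] show m: "?m = 0" by simp
  show "of_real (2 * x\<^sup>2) * r + ?p = cnj r * cnj r * of_real x" using o(1) m by simp
  show "of_real (2 * x * a $ i) * r + (\<Sum>l\<in>UNIV. of_real (a $ l * A $ i $ l) * s $ l)
     = cnj r * cnj (s $ i) * of_real (a $ i)" by (rule o(3))
  show "(\<Sum>l\<in>UNIV. of_real (d $ l * D $ j $ l) * t $ l) = cnj r * cnj (t $ j) * of_real (d $ j)"
    using o(4) by simp
  show "of_real (2 * a $ i * a $ i') * r + (\<Sum>l\<in>UNIV. of_real (A $ i $ l * A $ i' $ l) * s $ l)
     = cnj (s $ i) * cnj (s $ i') * of_real (A $ i $ i')"
    "of_real (2 * d $ j * d $ j') * r + (\<Sum>l\<in>UNIV. of_real (D $ j $ l * D $ j' $ l) * t $ l)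
     = cnj (t $ j) * cnj (t $ j') * of_real (D $ j $ j')"
    using eqs by blast+
qed

lemmas N_formula = verlinde_block[OF pos(1) pos(1) pos(2) pos(3), of A D]

lemma N_vacuum: "N Lab_0 j k = (if j = k then 1 else 0)"
  by (rule verlinde_vacuum[OF R])

lemma N_baa: "N Lab_b (Lab_a i) (Lab_a i') = (if i = i' then 1 else 0)"
  using pos(1) by (simp add: N_formula orth)

lemma N_bdd: "N Lab_b (Lab_d j) (Lab_d j') = 4 * d $ j * d $ j' - (if j = j' then 1 else 0)"
  using pos(1) by (simp add: N_formula orth)

lemma N_aad: "N (Lab_a i) (Lab_a i') (Lab_d j) = 0"
  by (simp add: N_formula)

text \<open>
  Two labels of type \<open>d\<close> are thus forced, exchanged by fusion with \<open>b\<close>. A single label fixed by \<open>b\<close>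
  would have \<open>d\<^sub>j\<^sup>2 = 1/2\<close>, so \<open>D = 0\<close>, and no twist can compensate the contribution of the vacuum.
\<close>

lemma d_half: "d $ j = 1 / 2"
proof -
  obtain c :: nat where "4 * d $ j * d $ j - 1 = real c"
    using nat[of Lab_b "Lab_d j" "Lab_d j"] by (auto simp: N_bdd elim!: Nats_cases)
  then have c: "4 * (d $ j)\<^sup>2 - 1 = real c" by (simp add: power2_eq_square mult.assoc)
  have "(d $ j)\<^sup>2 \<le> (\<Sum>l\<in>UNIV. (d $ l)\<^sup>2)" by (rule member_le_sum) auto
  then have "real c \<le> 1" using c orth(2) by simp
  then consider "c = 0" | "c = 1" by linarith
  then show ?thesis
  proof cases
    case 1
    then have "(d $ j)\<^sup>2 = (1 / 2)\<^sup>2" using c by (simp add: power2_eq_square)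
    then show ?thesis using pos(3)[of j] by (simp add: power2_eq_iff)
  next
    case 2
    then have dj: "2 * d $ j * d $ j = 1" using c by (simp add: power2_eq_square)
    have "(\<Sum>l\<in>UNIV. (D $ j $ l)\<^sup>2) = 0" using orth(6)[of j j] dj by (simp add: power2_eq_square)
    then have "D $ j $ l = 0" for l by (simp add: sum_nonneg_eq_0_iff)
    then have "r = 0" using twist(6)[of j j] dj by simp
    then show ?thesis using norms(1) by simp
  qed
qed

text \<open>
  Half the quantum dimension of \<open>a\<^sub>i\<close>. It is the multiplicity of \<open>a\<^sub>i\<close> in the product of any two labels of
  type \<open>d\<close>, hence an integer.
\<close>

definition "half_dim i = nat \<lfloor>a $ i / (2 * x)\<rfloor>"

lemma a_eq: "a $ i = 2 * x * real (half_dim i)"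
proof -
  have "N (Lab_a i) (Lab_d undefined) (Lab_d undefined) = a $ i / (2 * x)"
    using pos(1) by (simp add: N_formula d_half)
  then obtain c where "a $ i / (2 * x) = real c"
    using nat[of "Lab_a i" "Lab_d undefined" "Lab_d undefined"] by (auto elim!: Nats_cases)
  then show ?thesis using pos(1) by (simp add: half_dim_def field_simps)
qed

lemma half_dim_pos: "0 < half_dim i"
  using pos(1) pos(2)[of i] by (simp add: a_eq zero_less_mult_iff)

text \<open>
  Condensing \<open>b\<close> identifies \<open>0\<close> with \<open>b\<close> and splits each \<open>a\<^sub>i\<close> into two labels of dimension \<open>m\<^sub>i\<close>; this is
  the global dimension of the result. It is the integer \<open>M\<close> of the theorem.
\<close>

definition "gdim = 1 + 2 * (\<Sum>i\<in>UNIV. (int (half_dim i))\<^sup>2)"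

lemma gdim: "4 * x\<^sup>2 * of_int gdim = 1"
proof -
  have "(\<Sum>l\<in>UNIV. (a $ l)\<^sup>2) = 4 * x\<^sup>2 * (\<Sum>l\<in>UNIV. (real (half_dim l))\<^sup>2)"
    by (simp add: a_eq power_mult_distrib sum_distrib_left)
  then show ?thesis using orth(1) by (simp add: gdim_def algebra_simps)
qed

text \<open>
  Dimension count in the product of \<open>a\<^sub>i\<close> and \<open>a\<^sub>j\<close>: it contains \<open>0\<close> and \<open>b\<close> once each if \<open>i = j\<close>, and all
  other summands are of type \<open>a\<close>.
\<close>

lemma sum_N_half_dim: "(\<Sum>k\<in>UNIV. N (Lab_a i) (Lab_a j) (Lab_a k) * half_dim k) = 2 * real (half_dim i) * real (half_dim j) - (if i = j then 1 else 0)"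
proof -
  have N: "N (Lab_a i) (Lab_a j) Lab_0 = (if i = j then 1 else 0)" "N (Lab_a i) (Lab_a j) Lab_b = (if i = j then 1 else 0)"
    using N_vacuum[of "Lab_a i" "Lab_a j"] N_baa[of i j]
    by (simp_all add: verlinde_rotate[of Lab_0 _ "Lab_a i" "Lab_a j" Lab_0] verlinde_rotate[of Lab_0 _ "Lab_a i" "Lab_a j" Lab_b])
  have "2 * x * (\<Sum>k\<in>UNIV. N (Lab_a i) (Lab_a j) (Lab_a k) * half_dim k)
      = (\<Sum>k\<in>UNIV. N (Lab_a i) (Lab_a j) (Lab_a k) * a $ k)"
    by (simp add: a_eq sum_distrib_left mult.left_commute)
  also have "\<dots> + 2 * x * (if i = j then 1 else 0) = a $ i * a $ j / x"
    using sum_verlinde_dim[OF R, of "Lab_a i" "Lab_a j"] by (simp add: sum_lam_index N_aad N split: if_splits)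
  finally have "2 * x * (\<Sum>k\<in>UNIV. N (Lab_a i) (Lab_a j) (Lab_a k) * half_dim k)
      = 2 * x * (2 * real (half_dim i) * real (half_dim j) - (if i = j then 1 else 0))"
    using pos(1) by (simp add: a_eq field_simps split: if_splits)
  then show ?thesis using pos(1) by simp
qed

text \<open>
  The dimension count for \<open>i = j\<close> writes \<open>1\<close> as an integral combination of the half dimensions.
\<close>

lemma dvd_half_dim_imp_unit:
  assumes "\<And>i. g dvd half_dim i"
  shows "g = 1"
proof -
  fix i :: 'm
  have "\<exists>c. N (Lab_a i) (Lab_a i) (Lab_a k) = real c" for k
    using nat[of "Lab_a i" "Lab_a i" "Lab_a k"] by (auto elim!: Nats_cases)
  then obtain n where n: "\<And>k. N (Lab_a i) (Lab_a i) (Lab_a k) = real (n k)" by metis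
  have "real ((\<Sum>k\<in>UNIV. n k * half_dim k) + 1) = real (2 * half_dim i * half_dim i)"
    using sum_N_half_dim[of i i] by (simp add: n)
  then have "(\<Sum>k\<in>UNIV. n k * half_dim k) + 1 = 2 * half_dim i * half_dim i" by (simp only: of_nat_eq_iff)
  moreover have "g dvd (\<Sum>k\<in>UNIV. n k * half_dim k)" using assms by (intro dvd_sum) simp
  moreover have "g dvd 2 * half_dim i * half_dim i" using assms[of i] by simp
  ultimately have "g dvd 1" using dvd_add_right_iff by metis
  then show ?thesis by simp
qed

lemma sqrt_gdim: "sqrt (of_int gdim) = 1 / (2 * x)"
proof -
  have "of_int gdim = (1 / (2 * x))\<^sup>2" using gdim pos(1) by (simp add: field_simps power2_eq_square)
  then show ?thesis using pos(1) by (simp only: real_sqrt_abs) simp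
qed

lemma gdim_pos: "0 < gdim"
  by (simp add: gdim_def add_pos_nonneg sum_nonneg)

lemma laminated_integers_gdim: "laminated_integers x a d gdim 1 gdim"
proof -
  have "primitive_integral ((2 powi (1 - int 1) * sqrt (of_int gdim)) *\<^sub>R a)"
    unfolding primitive_integral_def
  proof (intro exI conjI allI)
    show "((2 powi (1 - int 1) * sqrt (of_int gdim)) *\<^sub>R a) $ i = of_int (int (half_dim i))" for i
      using pos(1) by (simp add: sqrt_gdim a_eq)
    have "Gcd (range (\<lambda>i. int (half_dim i))) dvd int (half_dim i)" for i by (rule Gcd_dvd) simp
    moreover obtain g where g: "Gcd (range (\<lambda>i. int (half_dim i))) = int g"
      using nonneg_int_cases[OF Gcd_int_greater_eq_0] by blast
    ultimately have "g dvd half_dim i" for i by (simp only: int_dvd_int_iff)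
    then show "Gcd (range (\<lambda>i. int (half_dim i))) = 1" using dvd_half_dim_imp_unit[of g] g by simp
  qed
  moreover have "primitive_integral ((2 * sqrt (of_int gdim / of_int gdim)) *\<^sub>R d)"
    unfolding primitive_integral_def using gdim_pos by (intro exI[of _ "\<lambda>_. 1"]) (simp add: d_half)
  ultimately show ?thesis
    using gdim_pos pos(1) by (simp add: laminated_integers_def sqrt_gdim)
qed

text \<open>
  \<open>M\<close> is determined by \<open>x\<close> and is odd, so \<open>4\<^sup>L\<close> divides \<open>4M\<close> only for \<open>L \<le> 1\<close>; for \<open>L = 0\<close> the vector
  that should be primitive is twice an integral one.
\<close>

lemma laminated_integers_unique:
  assumes "laminated_integers x a d M L K"
  shows "M = gdim" "L = 1"
proof -
  have M: "0 < M" "2 * x = 1 / sqrt (of_int M)" and dvd: "4 ^ L dvd 4 * M"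
    and prim: "primitive_integral ((2 powi (1 - int L) * sqrt (of_int M)) *\<^sub>R a)"
    using assms by (auto simp: laminated_integers_def)
  have "(1::real) = (2 * x)\<^sup>2 * of_int M" using M by (simp add: power_divide)
  then have "(4 * x\<^sup>2) * of_int M = (4 * x\<^sup>2) * of_int gdim" using gdim by (simp add: power_mult_distrib)
  then have "real_of_int M = of_int gdim" using pos(1) by simp
  then show "M = gdim" by simp
  then have "odd M" by (simp add: gdim_def)
  have "\<not> 2 \<le> L"
  proof
    assume "2 \<le> L"
    then have "(4::int) ^ 2 dvd 4 ^ L" by (rule le_imp_power_dvd)
    then have "16 dvd 4 * M" using dvd by (auto intro: dvd_trans)
    then show False using \<open>odd M\<close> by presburger
  qed
  moreover have "L \<noteq> 0"
  proof
    assume "L = 0"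
    then obtain c :: "'m \<Rightarrow> int" where c: "\<And>i. 2 * real (half_dim i) = of_int (c i)" and g: "Gcd (range c) = 1"
      using prim pos(1) unfolding primitive_integral_def \<open>M = gdim\<close> by (auto simp: sqrt_gdim a_eq)
    have "c i = 2 * int (half_dim i)" for i using c[of i] by linarith
    then have "2 dvd Gcd (range c)" by (intro Gcd_greatest) auto
    then show False using g by simp
  qed
  ultimately show "L = 1" by linarith
qed

text \<open>
  If the coefficient were at least \<open>2\<close>, the sum of the squared multiplicities in the product of \<open>a\<^sub>i\<close> and
  \<open>a\<^sub>j\<close> would be at least \<open>4\<close>. By associativity that sum is the number of common summands of the squares of
  \<open>a\<^sub>i\<close> and \<open>a\<^sub>j\<close>. Each square consists of \<open>0\<close>, \<open>b\<close> and, by the dimension count, one further label, which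
  gives at most \<open>3\<close>.
\<close>

lemma N_le_1:
  assumes "half_dim i = 1" "half_dim j = 1" "half_dim k = 1"
  shows "N (Lab_a i) (Lab_a j) (Lab_a k) \<le> 1"
proof (rule ccontr)
  assume gt: "\<not> N (Lab_a i) (Lab_a j) (Lab_a k) \<le> 1"
  have N0: "0 \<le> N i j k" for i j k using nat[of i j k] by (auto elim!: Nats_cases)
  obtain c where "N (Lab_a i) (Lab_a j) (Lab_a k) = real c"
    using nat[of "Lab_a i" "Lab_a j" "Lab_a k"] by (auto elim!: Nats_cases)
  then have N2: "2 \<le> N (Lab_a i) (Lab_a j) (Lab_a k)" using gt by simp
  have le: "N (Lab_a i) (Lab_a j) (Lab_a l) * half_dim l \<le> 2 * real (half_dim i) * real (half_dim j) - (if i = j then 1 else 0)" for i j l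
    unfolding sum_N_half_dim[symmetric] using N0
    by (intro member_le_sum[of l UNIV "\<lambda>l. N (Lab_a i) (Lab_a j) (Lab_a l) * half_dim l"]) auto
  have ij: "i \<noteq> j" using le[of i j k] N2 assms by auto
  have m1: "1 \<le> real (half_dim l)" for l using half_dim_pos[of l] by simp
  have "(N (Lab_a i) (Lab_a j) (Lab_a k))\<^sup>2 \<le> (\<Sum>l\<in>UNIV. (N (Lab_a i) (Lab_a j) l)\<^sup>2)"
    by (rule member_le_sum) auto
  then have "2\<^sup>2 \<le> (\<Sum>l\<in>UNIV. (N (Lab_a i) (Lab_a j) l)\<^sup>2)"
    using power_mono[OF N2, of 2] by simp
  also have "\<dots> = (\<Sum>l\<in>UNIV. N (Lab_a i) (Lab_a i) l * N (Lab_a j) (Lab_a j) l)"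
    by (simp add: power2_eq_square sum_verlinde_verlinde[OF R] mult.commute mult.left_commute)
  also have "\<dots> = 2 + (\<Sum>l\<in>UNIV. N (Lab_a i) (Lab_a i) (Lab_a l) * N (Lab_a j) (Lab_a j) (Lab_a l))"
  proof -
    have "N (Lab_a i) (Lab_a i) Lab_0 = 1" "N (Lab_a i) (Lab_a i) Lab_b = 1" for i
      using N_vacuum[of "Lab_a i" "Lab_a i"] N_baa[of i i]
      by (simp_all add: verlinde_rotate[of Lab_0 _ "Lab_a i" "Lab_a i" Lab_0] verlinde_rotate[of Lab_0 _ "Lab_a i" "Lab_a i" Lab_b])
    then show ?thesis by (simp add: sum_lam_index N_aad)
  qed
  also have "\<dots> \<le> 2 + (\<Sum>l\<in>UNIV. N (Lab_a i) (Lab_a i) (Lab_a l) * half_dim l)"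
  proof (intro add_left_mono sum_mono mult_left_mono N0)
    fix l
    have "N (Lab_a j) (Lab_a j) (Lab_a l) * half_dim l \<le> 1" using le[of j j l] assms by simp
    moreover have "N (Lab_a j) (Lab_a j) (Lab_a l) * 1 \<le> N (Lab_a j) (Lab_a j) (Lab_a l) * half_dim l"
      by (intro mult_left_mono m1 N0)
    ultimately show "N (Lab_a j) (Lab_a j) (Lab_a l) \<le> real (half_dim l)" using m1[of l] by simp
  qed
  also have "\<dots> = 3" using sum_N_half_dim[of i i] assms by simp
  finally show False by simp
qed

end

section \<open>From matrices to block data\<close>

lemma of_real_in_Nats_iff: "complex_of_real y \<in> \<nat> \<longleftrightarrow> y \<in> \<nat>"
proof
  assume "complex_of_real y \<in> \<nat>"
  then obtain n where "complex_of_real y = of_nat n" by (auto elim: Nats_cases)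
  then have "y = real n" by (metis of_real_eq_iff of_real_of_nat_eq)
  then show "y \<in> \<nat>" by simp
qed (auto elim!: Nats_cases)

lemma of_real_in_Ints_iff: "complex_of_real y \<in> \<int> \<longleftrightarrow> y \<in> \<int>"
proof
  assume "complex_of_real y \<in> \<int>"
  then obtain n where "complex_of_real y = of_int n" by (auto elim: Ints_cases)
  then have "y = of_int n" by (metis of_real_eq_iff of_real_of_int_eq)
  then show "y \<in> \<int>" by simp
qed (auto elim!: Ints_cases)

lemma fusion_block_S: "fusion Lab_0 (block_S p q a d A D) i j k
    = of_real (verlinde Lab_0 (block_entry p q a d A D) i j k)"
  by (rule fusion_eq_verlinde) (simp add: block_S_def)

lemma pre_modular_data_block_iff:
  "pre_modular_data Lab_0 (block_S p q a d A D) (block_T r s t) \<and> unitary_real Lab_0 (block_S p q a d A D)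
    \<longleftrightarrow> real_modular Lab_0 (block_entry p q a d A D) (block_twist r s t)"
  by (rule pre_modular_data_iff_real_modular) (simp_all add: block_S_def block_T_def block_twist_def)

text \<open>
  Charge conjugation is trivial, so \<open>N\<^bsub>i,j,k\<^esub>\<close> is the same as \<open>N\<^bsub>i,j\<^esub>\<^bsup>k\<^esup>\<close>.
\<close>

lemma Z2_laminated_imp_block:
  fixes e :: "('m::finite, 'n::finite) lam_index \<Rightarrow> 'p::finite"
  assumes lam: "Z2_laminated z S T e"
    and eS: "reindex e S = block_S x x a d A D" and eT: "reindex e T = block_T r s t"
  shows "laminated_block x r a d A D s t"
    and "fusion3 z S (e i) (e j) (e k) = of_real (verlinde Lab_0 (block_entry x x a d A D) i j k)"
proof -
  define u where "u i j = Re (S $ i $ j)" for i j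
  define w where "w i = T $ i $ i" for i
  have md: "modular_data z S T" and ur: "unitary_real z S" and e: "bij e" and e0: "e Lab_0 = z"
    using lam by (auto simp: Z2_laminated_def)
  have S: "S $ i $ j = of_real (u i j)" for i j
    using ur by (simp add: unitary_real_def u_def of_real_Re)
  have T: "T $ i $ j = (if i = j then w i else 0)" for i j
    using md by (auto simp: modular_data_def pre_modular_data_def diagonal_matrix_def w_def)
  have R: "real_modular (e Lab_0) u w"
    using pre_modular_data_iff_real_modular[OF S T, of z] md ur by (simp add: modular_data_def e0)
  have u: "u (e i) (e j) = block_entry x x a d A D i j" for i j
  proof -
    have "S $ e i $ e j = of_real (block_entry x x a d A D i j)"
      using arg_cong[OF eS, of "\<lambda>M. M $ i $ j"] by (simp add: reindex_def block_S_def)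
    then show ?thesis by (simp add: u_def)
  qed
  have w: "w (e i) = block_twist r s t i" for i
    using arg_cong[OF eT, of "\<lambda>M. M $ i $ i"] by (simp add: reindex_def block_T_def block_twist_def w_def)
  have fus: "fusion z S (e i) (e j) (e k) = of_real (verlinde Lab_0 (block_entry x x a d A D) i j k)" for i j k
    using fusion_eq_verlinde[OF S, of z] verlinde_reindex[OF e, of Lab_0 u] by (simp add: e0 u)
  show "laminated_block x r a d A D s t"
  proof
    show "real_modular Lab_0 (block_entry x x a d A D) (block_twist r s t)"
      using real_modular_reindex[where e = e, OF R e] by (simp add: u w)
    show "verlinde Lab_0 (block_entry x x a d A D) i j k \<in> \<nat>" for i j k
      using md unfolding modular_data_def of_real_in_Nats_iff[symmetric] fus[symmetric] by blast
  qed
  have "(S ** S) $ k $ l = of_real (if k = l then 1 else 0)" for k l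
  proof -
    have "(S ** S) $ k $ l = of_real (\<Sum>i\<in>UNIV. u k i * u l i)"
      by (simp add: matrix_matrix_mult_def S real_modularD(1)[OF R, of l])
    then show ?thesis by (simp only: real_modularD(2)[OF R])
  qed
  then have "charge_conj S l = l" for l
    by (auto simp: charge_conj_def intro!: the_equality split: if_splits)
  then show "fusion3 z S (e i) (e j) (e k) = of_real (verlinde Lab_0 (block_entry x x a d A D) i j k)"
    by (simp add: fusion3_def fus)
qed

section \<open>Gluing with equal vacuum entries\<close>

text \<open>
  Subtracting the two Gauss sums of laminated data shows that the \<open>d\<close>-labels contribute \<open>0\<close> to each, and
  their norm is always \<open>1/2\<close>. The \<open>d\<close>-block can therefore be exchanged for any other with the same
  \<open>x\<close> and \<open>r\<close>.
\<close>

lemma glue_same_vacuum: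
  assumes L: "laminated_block x r a d A D s t" and L': "laminated_block x r a' d' A' D' s' t'"
  shows "laminated_block x r a d' A D' s t'"
proof -
  interpret L: laminated_block x r a d A D s t by fact
  interpret L': laminated_block x r a' d' A' D' s' t' by fact
  have R: "real_modular Lab_0 (block_entry x x a d' A D') (block_twist r s t')"
  proof -
    have o: "x\<^sup>2 + x\<^sup>2 + (\<Sum>l\<in>UNIV. (a $ l)\<^sup>2) + (\<Sum>l\<in>UNIV. (d' $ l)\<^sup>2) = 1"
      "2 * x * x + (\<Sum>l\<in>UNIV. (a $ l)\<^sup>2) - (\<Sum>l\<in>UNIV. (d' $ l)\<^sup>2) = 0"
      using L.orth(1) L'.orth(2) by (simp_all add: power2_eq_square)
    have tw: "of_real (x\<^sup>2 + x\<^sup>2) * r + (\<Sum>l\<in>UNIV. of_real ((a $ l)\<^sup>2) * s $ l)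
        + (\<Sum>l\<in>UNIV. of_real ((d' $ l)\<^sup>2) * t' $ l) = cnj r * cnj r * of_real x"
      "of_real (2 * x * x) * r + (\<Sum>l\<in>UNIV. of_real ((a $ l)\<^sup>2) * s $ l)
        - (\<Sum>l\<in>UNIV. of_real ((d' $ l)\<^sup>2) * t' $ l) = cnj r * cnj r * of_real x"
      using L.twist(1) L'.twist(2) by (simp_all add: power2_eq_square mult.assoc)
    show ?thesis
      unfolding real_modular_block_iff
      using L.pos L'.pos L.norms L'.norms L.sym L'.sym o tw L.orth(3,5) L'.orth(4,6) L.twist(3,5) L'.twist(4,6)
      by (auto simp: algebra_simps)
  qed
  have "verlinde Lab_0 (block_entry x x a d' A D') i j k \<in> \<nat>" for i j k
  proof (rule verlinde_block_in[OF R])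
    note f = verlinde_block[OF L.pos(1) L.pos(1) L.pos(2) L'.pos(3), of A D']
    let ?N = "verlinde Lab_0 (block_entry x x a d' A D')"
    show "?N Lab_b Lab_b Lab_b \<in> \<nat>" 
      using L.nat[of Lab_b Lab_b Lab_b] unfolding f L.N_formula by (simp add: L.orth L'.orth)
    show "?N Lab_b Lab_b (Lab_a i) \<in> \<nat>" for i
      using L.nat[of Lab_b Lab_b "Lab_a i"] unfolding f L.N_formula .
    show "?N Lab_b Lab_b (Lab_d i) \<in> \<nat>" for i
      using L'.nat[of Lab_b Lab_b "Lab_d i"] unfolding f L'.N_formula .
    show "?N Lab_b (Lab_a i) (Lab_a j) \<in> \<nat>" for i j
      using L.nat[of Lab_b "Lab_a i" "Lab_a j"] unfolding f L.N_formula .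
    show "?N Lab_b (Lab_a i) (Lab_d j) \<in> \<nat>" for i j
      unfolding f by simp
    show "?N Lab_b (Lab_d i) (Lab_d j) \<in> \<nat>" for i j
      using L'.nat[of Lab_b "Lab_d i" "Lab_d j"] unfolding f L'.N_formula .
    show "?N (Lab_a i) (Lab_a j) (Lab_a k) \<in> \<nat>" for i j k
      using L.nat[of "Lab_a i" "Lab_a j" "Lab_a k"] unfolding f L.N_formula .
    show "?N (Lab_a i) (Lab_a j) (Lab_d k) \<in> \<nat>" for i j k
      unfolding f by simp
    show "?N (Lab_a i) (Lab_d j) (Lab_d k) \<in> \<nat>" for i j k
      using L.pos(1) unfolding f by (simp add: L.a_eq L'.d_half)
    show "?N (Lab_d i) (Lab_d j) (Lab_d k) \<in> \<nat>" for i j k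
      using L'.nat[of "Lab_d i" "Lab_d j" "Lab_d k"] unfolding f L'.N_formula .
  qed simp_all
  with R show ?thesis by unfold_locales
qed

section \<open>Gluing with different vacuum entries\<close>

locale laminated_pair =
  L: laminated_block x r a d A D s t + L': laminated_block x' r' a' d' A' D' s' t'
  for x r a d A D s t and x' r' a' d' A' D' s' t' +
  fixes \<omega> :: complex
  assumes less: "x' < x" and root: "\<omega> ^ 3 = 1" and r: "r = - (r' * \<omega>)"
begin

abbreviation "u \<equiv> block_entry (x - x') (x + x') a a' A (- A')"

lemma norm_root: "norm \<omega> = 1"
proof -
  have "norm \<omega> ^ 3 = 1" using root by (metis norm_power norm_one)
  then show ?thesis using power_eq_imp_eq_base[of "norm \<omega>" 3 1] by simp
qed

text \<open>
  This is where third roots of unity enter: scaling the twists by \<open>-\<omega>\<close> multiplies the left-hand side of the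
  twist equation by \<open>-\<omega>\<close> and the right-hand side by \<open>\<omega>\<close>. The sign is absorbed by replacing the matrix \<open>S'\<close>
  by its negative, since the left-hand side is quadratic in it.
\<close>

lemma root_cnj: "cnj \<omega> * cnj \<omega> = \<omega>"
proof -
  have "\<omega> * cnj \<omega> = 1" using norm_root complex_norm_square[of \<omega>] by simp
  have "cnj \<omega> * cnj \<omega> = \<omega> ^ 3 * (cnj \<omega> * cnj \<omega>)" by (simp add: root)
  also have "\<dots> = (\<omega> * cnj \<omega>) * (\<omega> * cnj \<omega>) * \<omega>" by (simp add: power3_eq_cube mult.commute mult.left_commute)
  finally show ?thesis by (simp add: \<open>\<omega> * cnj \<omega> = 1\<close>)
qed

text \<open>
  After rescaling the second data by \<open>-\<omega>\<close>, the equations at \<open>(0, 0)\<close> and \<open>(0, b)\<close> are the difference and the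
  sum of those of the given data; every other equation is inherited from one of the two.
\<close>

lemma real_modular_glued:
  "real_modular Lab_0 u (block_twist r s (\<chi> k. - \<omega> * s' $ k))"
proof -
  have c: "cnj (- \<omega> * v) * cnj (- \<omega> * v') = \<omega> * (cnj v * cnj v')" for v v'
  proof -
    have "cnj (- \<omega> * v) * cnj (- \<omega> * v') = (cnj \<omega> * cnj \<omega>) * (cnj v * cnj v')" by simp
    then show ?thesis by (simp only: root_cnj)
  qed
  have cr: "cnj r * cnj r = \<omega> * (cnj r' * cnj r')" "cnj r * cnj (- \<omega> * v) = \<omega> * (cnj r' * cnj v)" for v
  proof -
    have r: "r = - \<omega> * r'" by (simp add: r)
    show "cnj r * cnj r = \<omega> * (cnj r' * cnj r')" "cnj r * cnj (- \<omega> * v) = \<omega> * (cnj r' * cnj v)"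
      unfolding r by (rule c)+
  qed
  have sum: "(\<Sum>l\<in>UNIV. of_real (f l) * (- \<omega> * s' $ l)) = - \<omega> * (\<Sum>l\<in>UNIV. of_real (f l) * s' $ l)" for f
    by (simp add: sum_distrib_left sum_negf mult.left_commute)
  let ?s = "\<chi> k. - \<omega> * s' $ k"
  have p: "0 < x - x'" "0 < x + x'" using less L.pos(1) L'.pos(1) by simp_all
  have n: "norm (?s $ k) = 1" for k by (simp add: norm_mult norm_root L'.norms)
  have o1: "(x - x')\<^sup>2 + (x + x')\<^sup>2 + (\<Sum>l\<in>UNIV. (a $ l)\<^sup>2) + (\<Sum>l\<in>UNIV. (a' $ l)\<^sup>2) = 1"
    "2 * (x - x') * (x + x') + (\<Sum>l\<in>UNIV. (a $ l)\<^sup>2) - (\<Sum>l\<in>UNIV. (a' $ l)\<^sup>2) = 0"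
    using L.orth(1) L'.orth(1) by (simp_all add: power2_eq_square algebra_simps)
  have o2: "(x - x' + (x + x')) * a $ i + (\<Sum>l\<in>UNIV. a $ l * A $ i $ l) = 0"
    "2 * a $ i * a $ i' + (\<Sum>l\<in>UNIV. A $ i $ l * A $ i' $ l) = (if i = i' then 1 else 0)" for i i'
    by (simp_all add: L.orth)
  have o3: "(x - x' - (x + x')) * a' $ i + (\<Sum>l\<in>UNIV. a' $ l * (- A') $ i $ l) = 0"
    "2 * a' $ i * a' $ i' + (\<Sum>l\<in>UNIV. (- A') $ i $ l * (- A') $ i' $ l) = (if i = i' then 1 else 0)" for i i'
    by (simp_all add: L'.orth sum_negf)
  let ?P = "\<Sum>l\<in>UNIV. of_real ((a $ l)\<^sup>2) * s $ l"
    and ?Q = "\<Sum>l\<in>UNIV. of_real ((a' $ l)\<^sup>2) * s' $ l"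
  have t0: "of_real (2 * x'\<^sup>2) * r + - \<omega> * ?Q = - (cnj r * cnj r * of_real x')"
  proof -
    have "of_real (2 * x'\<^sup>2) * r + - \<omega> * ?Q = - \<omega> * (of_real (2 * x'\<^sup>2) * r' + ?Q)"
      by (simp add: r algebra_simps)
    then show ?thesis by (simp only: L'.twist(1) cr) simp
  qed
  have t1: "of_real ((x - x')\<^sup>2 + (x + x')\<^sup>2) * r + ?P + (\<Sum>l\<in>UNIV. of_real ((a' $ l)\<^sup>2) * ?s $ l)
      = cnj r * cnj r * of_real (x - x')"
  proof -
    have "of_real ((x - x')\<^sup>2 + (x + x')\<^sup>2) * r + ?P + - \<omega> * ?Q
      = (of_real (2 * x\<^sup>2) * r + ?P) + (of_real (2 * x'\<^sup>2) * r + - \<omega> * ?Q)"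
      by (simp add: power2_eq_square algebra_simps)
    also have "\<dots> = cnj r * cnj r * of_real (x - x')"
      unfolding L.twist(1) t0 by (simp add: algebra_simps)
    finally show ?thesis by (simp only: vec_lambda_beta sum)
  qed
  have t2: "of_real (2 * (x - x') * (x + x')) * r + ?P - (\<Sum>l\<in>UNIV. of_real ((a' $ l)\<^sup>2) * ?s $ l)
      = cnj r * cnj r * of_real (x + x')"
  proof -
    have "of_real (2 * (x - x') * (x + x')) * r + ?P - - \<omega> * ?Q
      = (of_real (2 * x\<^sup>2) * r + ?P) - (of_real (2 * x'\<^sup>2) * r + - \<omega> * ?Q)"
      by (simp add: power2_eq_square algebra_simps)
    also have "\<dots> = cnj r * cnj r * of_real (x + x')"
      unfolding L.twist(1) t0 by (simp add: algebra_simps)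
    finally show ?thesis by (simp only: vec_lambda_beta sum)
  qed
  have t3: "of_real ((x - x' + (x + x')) * a $ i) * r + (\<Sum>l\<in>UNIV. of_real (a $ l * A $ i $ l) * s $ l)
      = cnj r * cnj (s $ i) * of_real (a $ i)" for i
    using L.twist(3)[of i] by (simp only: mult_2 add_diff_eq diff_add_cancel) simp
  have t4: "of_real ((x - x' - (x + x')) * a' $ i) * r + (\<Sum>l\<in>UNIV. of_real (a' $ l * (- A') $ i $ l) * ?s $ l)
      = cnj r * cnj (?s $ i) * of_real (a' $ i)" for i
  proof -
    have "of_real ((x - x' - (x + x')) * a' $ i) * r + - \<omega> * (\<Sum>l\<in>UNIV. of_real (a' $ l * (- A') $ i $ l) * s' $ l)
        = \<omega> * (of_real (2 * x' * a' $ i) * r' + (\<Sum>l\<in>UNIV. of_real (a' $ l * A' $ i $ l) * s' $ l))"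
      by (simp add: r sum_negf algebra_simps)
    also have "\<dots> = cnj r * cnj (- \<omega> * s' $ i) * of_real (a' $ i)"
      by (simp only: L'.twist(3) cr) (simp only: mult.assoc)
    finally show ?thesis by (simp only: vec_lambda_beta sum)
  qed
  have t6: "of_real (2 * a' $ i * a' $ j) * r + (\<Sum>l\<in>UNIV. of_real ((- A') $ i $ l * (- A') $ j $ l) * ?s $ l)
      = cnj (?s $ i) * cnj (?s $ j) * of_real ((- A') $ i $ j)" for i j
  proof -
    have "of_real (2 * a' $ i * a' $ j) * r + - \<omega> * (\<Sum>l\<in>UNIV. of_real ((- A') $ i $ l * (- A') $ j $ l) * s' $ l)
        = - \<omega> * (of_real (2 * a' $ i * a' $ j) * r' + (\<Sum>l\<in>UNIV. of_real (A' $ i $ l * A' $ j $ l) * s' $ l))"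
      by (simp add: r algebra_simps)
    also have "\<dots> = cnj (- \<omega> * s' $ i) * cnj (- \<omega> * s' $ j) * of_real ((- A') $ i $ j)"
      by (simp only: L'.twist(5) c) simp
    finally show ?thesis by (simp only: vec_lambda_beta sum)
  qed
  have syms: "A $ i $ j = A $ j $ i" "(- A') $ k $ l = (- A') $ l $ k" for i j k l
    using L.sym(1)[of i j] L'.sym(1)[of k l] by simp_all
  show ?thesis
    unfolding real_modular_block_iff
    by (intro conjI allI p o1 o2 o3 n L.norms L.pos L'.pos syms t1 t2 t3 t4 t6 L.twist(5))
qed

abbreviation "m \<equiv> L.half_dim"
abbreviation "m' \<equiv> L'.half_dim"
abbreviation "V \<equiv> verlinde Lab_0 u"

text \<open>
  The number \<open>4/(M' - M)\<close>, see \<open>kappa_gdim\<close>.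
\<close>

definition "\<kappa> = 16 * x\<^sup>2 * x'\<^sup>2 / (x\<^sup>2 - x'\<^sup>2)"

lemma kappa_eq:
  assumes "y = (q + p) / 2" "y' = (q - p) / 2" "p * q \<noteq> (0::real)"
  shows "16 * y\<^sup>2 * y'\<^sup>2 / (y\<^sup>2 - y'\<^sup>2) = (q\<^sup>2 - p\<^sup>2)\<^sup>2 / (p * q)"
proof -
  have "y\<^sup>2 - y'\<^sup>2 = p * q" "16 * y\<^sup>2 * y'\<^sup>2 = (q\<^sup>2 - p\<^sup>2)\<^sup>2"
    unfolding assms(1,2) by (simp_all add: power2_eq_square field_simps)
  then show ?thesis by simp
qed

lemma kappa_gdim: "\<kappa> * of_int (L'.gdim - L.gdim) = 4"
proof -
  have "x'\<^sup>2 < x\<^sup>2" using less L'.pos(1) by (simp add: power_strict_mono)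
  have "x\<^sup>2 * x'\<^sup>2 * (4 * of_int (L'.gdim - L.gdim)) = x\<^sup>2 * (4 * x'\<^sup>2 * of_int L'.gdim) - x'\<^sup>2 * (4 * x\<^sup>2 * of_int L.gdim)"
    by (simp add: algebra_simps)
  then have "x\<^sup>2 * x'\<^sup>2 * (4 * of_int (L'.gdim - L.gdim)) = x\<^sup>2 - x'\<^sup>2"
    by (simp only: L.gdim L'.gdim)
  then show ?thesis using \<open>x'\<^sup>2 < x\<^sup>2\<close> by (simp add: \<kappa>_def field_simps)
qed

lemma gdim_less: "L.gdim < L'.gdim"
proof -
  have "x'\<^sup>2 < x\<^sup>2" using less L'.pos(1) by (simp add: power_strict_mono)
  then have "0 < \<kappa>" using L.pos(1) L'.pos(1) by (simp add: \<kappa>_def)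
  then have "(0::real) < of_int (L'.gdim - L.gdim)" using kappa_gdim by (metis zero_less_mult_pos zero_less_numeral)
  then show ?thesis by simp
qed

text \<open>
  In terms of \<open>p = x - x'\<close> and \<open>q = x + x'\<close>, the given data have vacuum entries \<open>(q + p)/2\<close> and \<open>(q - p)/2\<close>,
  and \<open>\<kappa> = (q\<^sup>2 - p\<^sup>2)\<^sup>2/(pq)\<close>. Each formula is then an identity of rational functions in \<open>p\<close> and \<open>q\<close>.
\<close>

lemma V_formula:
  "V Lab_b Lab_b Lab_b = \<kappa>"
  "V Lab_b Lab_b (Lab_a i) = \<kappa> * m i"
  "V Lab_b Lab_b (Lab_d k) = \<kappa> * m' k"
  "V Lab_b (Lab_a i) (Lab_a i') = \<kappa> * (m i * m i') + (if i = i' then 1 else 0)"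
  "V Lab_b (Lab_a i) (Lab_d k) = \<kappa> * (m i * m' k)"
  "V Lab_b (Lab_d k) (Lab_d k') = \<kappa> * (m' k * m' k') - (if k = k' then 1 else 0)"
  "V (Lab_a i) (Lab_a i') (Lab_a i'') = \<kappa> * (m i * m i' * m i'') + L.N (Lab_a i) (Lab_a i') (Lab_a i'')"
  "V (Lab_a i) (Lab_a i') (Lab_d k) = \<kappa> * (m i * m i' * m' k)"
  "V (Lab_a i) (Lab_d k) (Lab_d k') = \<kappa> * (m i * m' k * m' k')"
  "V (Lab_d k) (Lab_d k') (Lab_d k'') = \<kappa> * (m' k * m' k' * m' k'') - L'.N (Lab_a k) (Lab_a k') (Lab_a k'')"
proof -
  define p where "p = x - x'"
  define q where "q = x + x'"
  have p: "0 < p" and q: "0 < q" using less L.pos(1) L'.pos(1) by (simp_all add: p_def q_def)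
  have x: "x = (q + p) / 2" and x': "x' = (q - p) / 2" by (simp_all add: p_def q_def)
  have xp: "0 < q + p" "0 < q - p" using L.pos(1) L'.pos(1) unfolding x x' by simp_all
  have \<kappa>: "\<kappa> = (q\<^sup>2 - p\<^sup>2)\<^sup>2 / (p * q)"
    unfolding \<kappa>_def using p q by (intro kappa_eq x x') simp
  have a: "a $ i = (q + p) * real (m i)" and a': "a' $ k = (q - p) * real (m' k)" for i k
    using L.a_eq[of i] L'.a_eq[of k] by (simp_all add: p_def q_def)
  note f = verlinde_block[OF p q L.pos(2) L'.pos(2), of A "- A'"]
  \<comment> \<open>For three labels from the same block, with \<open>c\<close> twice the vacuum entry of the given data: the old
    vacuum term has to be removed from the old fusion coefficient.\<close>
  have cube: "(c ^ 3 * w - 4 * c\<^sup>2) * (k * l * n) = (c * k) * (c * l) * (c * n) * w - 4 / c * ((c * k) * (c * l) * (c * n))"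
    "(c ^ 3 * w + 4 * c\<^sup>2) * (k * l * n) = (c * k) * (c * l) * (c * n) * w + 4 / c * ((c * k) * (c * l) * (c * n))"
    if "c \<noteq> 0" for c w k l n :: real
    using that by (simp_all add: field_simps power2_eq_square power3_eq_cube)
  have V: "V = verlinde Lab_0 (block_entry p q a a' A (- A'))" by (simp only: p_def q_def)
  have sum1: "(\<Sum>l\<in>UNIV. (a $ l)\<^sup>2) - (\<Sum>l\<in>UNIV. (a' $ l)\<^sup>2) = 2 * x'\<^sup>2 - 2 * x\<^sup>2"
    using L.orth(1) L'.orth(1) by linarith
  have sum2: "(\<Sum>l\<in>UNIV. a $ l * A $ i $ l) = - (q + p) * a $ i"
    "(\<Sum>l\<in>UNIV. A $ i $ l * A $ i' $ l) = (if i = i' then 1 else 0) - 2 * a $ i * a $ i'"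
    "(\<Sum>l\<in>UNIV. A $ i $ l * A $ i' $ l * A $ i'' $ l / a $ l)
       = L.N (Lab_a i) (Lab_a i') (Lab_a i'') - 4 / (q + p) * (a $ i * a $ i' * a $ i'')" for i i' i''
    using xp by (simp_all add: L.orth L.N_formula) (simp_all add: x field_simps)
  have sum3: "(\<Sum>l\<in>UNIV. a' $ l * (- A') $ k $ l) = (q - p) * a' $ k"
    "(\<Sum>l\<in>UNIV. (- A') $ k $ l * (- A') $ k' $ l) = (if k = k' then 1 else 0) - 2 * a' $ k * a' $ k'"
    "(\<Sum>l\<in>UNIV. (- A') $ k $ l * (- A') $ k' $ l * (- A') $ k'' $ l / a' $ l)
       = 4 / (q - p) * (a' $ k * a' $ k' * a' $ k'') - L'.N (Lab_a k) (Lab_a k') (Lab_a k'')" for k k' k''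
    using xp by (simp_all add: L'.orth L'.N_formula sum_negf) (simp_all add: x' field_simps)
  have "V Lab_b Lab_b Lab_b = q ^ 3 / p + p ^ 3 / q + (2 * x'\<^sup>2 - 2 * x\<^sup>2)"
    unfolding V f using sum1 by linarith
  also have "\<dots> = \<kappa>"
    unfolding \<kappa> unfolding x x' using p q
    by (simp add: field_simps power2_eq_square power3_eq_cube)
  finally show "V Lab_b Lab_b Lab_b = \<kappa>" .
  show "V Lab_b Lab_b (Lab_a i) = \<kappa> * m i"
    unfolding V f sum2 sum3 unfolding \<kappa> a a' using p q
    by (simp add: field_simps power2_eq_square)
  show "V Lab_b Lab_b (Lab_d k) = \<kappa> * m' k"
    unfolding V f sum2 sum3 unfolding \<kappa> a a' using p q
    by (simp add: field_simps power2_eq_square)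
  show "V Lab_b (Lab_a i) (Lab_a i') = \<kappa> * (m i * m i') + (if i = i' then 1 else 0)"
    unfolding V f sum2 sum3 unfolding \<kappa> a a' using p q
    by (simp add: field_simps power2_eq_square)
  show "V Lab_b (Lab_a i) (Lab_d k) = \<kappa> * (m i * m' k)"
    unfolding V f sum2 sum3 unfolding \<kappa> a a' using p q
    by (simp add: field_simps power2_eq_square)
  show "V Lab_b (Lab_d k) (Lab_d k') = \<kappa> * (m' k * m' k') - (if k = k' then 1 else 0)"
    unfolding V f sum2 sum3 unfolding \<kappa> a a' using p q
    by (simp add: field_simps power2_eq_square)
  show "V (Lab_a i) (Lab_a i') (Lab_a i'') = \<kappa> * (m i * m i' * m i'') + L.N (Lab_a i) (Lab_a i') (Lab_a i'')"
  proof -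
    have "(q + p) ^ 3 * (1 / p + 1 / q) - 4 * (q + p)\<^sup>2 = \<kappa>"
      unfolding \<kappa> using p q by (simp add: field_simps power2_eq_square power3_eq_cube)
    then have "\<kappa> * (m i * m i' * m i'')
        = ((q + p) ^ 3 * (1 / p + 1 / q) - 4 * (q + p)\<^sup>2) * (m i * m i' * m i'')" by simp
    also have "\<dots> = a $ i * a $ i' * a $ i'' * (1 / p + 1 / q) - 4 / (q + p) * (a $ i * a $ i' * a $ i'')"
      unfolding a using cube(1)[of "q + p" "1 / p + 1 / q"] xp by simp
    finally show ?thesis unfolding V f sum2 by linarith
  qed
  show "V (Lab_a i) (Lab_a i') (Lab_d k) = \<kappa> * (m i * m i' * m' k)"
    unfolding V f sum2 sum3 unfolding \<kappa> a a' using p q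
    by (simp add: field_simps power2_eq_square)
  show "V (Lab_a i) (Lab_d k) (Lab_d k') = \<kappa> * (m i * m' k * m' k')"
    unfolding V f sum2 sum3 unfolding \<kappa> a a' using p q
    by (simp add: field_simps power2_eq_square)
  show "V (Lab_d k) (Lab_d k') (Lab_d k'') = \<kappa> * (m' k * m' k' * m' k'') - L'.N (Lab_a k) (Lab_a k') (Lab_a k'')"
  proof -
    have "(q - p) ^ 3 * (1 / p - 1 / q) + 4 * (q - p)\<^sup>2 = \<kappa>"
      unfolding \<kappa> using p q by (simp add: field_simps power2_eq_square power3_eq_cube)
    then have "\<kappa> * (m' k * m' k' * m' k'')
        = ((q - p) ^ 3 * (1 / p - 1 / q) + 4 * (q - p)\<^sup>2) * (m' k * m' k' * m' k'')" by simp
    also have "\<dots> = a' $ k * a' $ k' * a' $ k'' * (1 / p - 1 / q) + 4 / (q - p) * (a' $ k * a' $ k' * a' $ k'')"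
      unfolding a' using cube(2)[of "q - p" "1 / p - 1 / q"] xp by simp
    finally show ?thesis unfolding V f sum3 by linarith
  qed
qed

text \<open>
  The coefficient at \<open>(b, b, b)\<close> is \<open>\<kappa> = 4/(M' - M)\<close>, and all others are integral combinations of \<open>1\<close>, \<open>\<kappa>\<close>
  and coefficients of the given data.
\<close>

lemma glued_fusion_integral_iff:
  "(\<forall>i j k. V i j k \<in> \<int>) \<longleftrightarrow> L'.gdim - L.gdim dvd 4"
proof
  assume "\<forall>i j k. V i j k \<in> \<int>"
  then have "V Lab_b Lab_b Lab_b \<in> \<int>" by blast
  then obtain c where "\<kappa> = of_int c" unfolding V_formula by (auto elim: Ints_cases)
  then have "real_of_int (c * (L'.gdim - L.gdim)) = of_int 4" using kappa_gdim by simp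
  then have "4 = (L'.gdim - L.gdim) * c" by (simp only: of_int_eq_iff mult.commute)
  then show "L'.gdim - L.gdim dvd 4" by (rule dvdI)
next
  assume "L'.gdim - L.gdim dvd 4"
  then obtain c where "4 = (L'.gdim - L.gdim) * c" by (rule dvdE)
  then have "\<kappa> * of_int (L'.gdim - L.gdim) = of_int c * of_int (L'.gdim - L.gdim)"
    unfolding kappa_gdim by (metis of_int_mult of_int_numeral mult.commute)
  then have "\<kappa> = of_int c" using gdim_less by simp
  then have \<kappa>: "\<kappa> \<in> \<int>" by simp
  have N: "L.N i j k \<in> \<int>" "L'.N i' j' k' \<in> \<int>" for i j k i' j' k'
    using L.nat L'.nat Nats_subset_Ints by blast+
  have "V i j k \<in> \<int>" for i j k
    by (rule verlinde_block_in[OF real_modular_glued]; (unfold V_formula)?)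
       (auto intro!: Ints_mult Ints_add Ints_diff \<kappa> N)
  then show "\<forall>i j k. V i j k \<in> \<int>" by blast
qed

text \<open>
  The bound controls \<open>N'\<close> when the product of the three half dimensions is at least \<open>2\<close>; otherwise
  \<open>N' \<le> 1 \<le> \<kappa>\<close>.
\<close>

lemma glued_fusion_nat:
  assumes dvd: "L'.gdim - L.gdim dvd 4"
    and le: "\<And>i j k. L'.N (Lab_a i) (Lab_a j) (Lab_a k) \<le> 2 * \<kappa>"
  shows "V i j k \<in> \<nat>"
proof -
  have int: "V i j k \<in> \<int>" for i j k using glued_fusion_integral_iff dvd by blast
  have "V Lab_b Lab_b Lab_b \<in> \<int>" by (rule int)
  then obtain c where c: "\<kappa> = of_int c" unfolding V_formula by (auto elim: Ints_cases)
  have "0 < \<kappa>" using kappa_gdim gdim_less by (metis of_int_0_less_iff zero_less_mult_pos2 zero_less_numeral diff_gt_0_iff_gt)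
  then have \<kappa>1: "1 \<le> \<kappa>" using c by simp
  have N: "0 \<le> L.N i j k" for i j k using L.nat[of i j k] by (auto elim!: Nats_cases)
  have m': "1 \<le> m' k" for k using L'.half_dim_pos[of k] by simp
  have bdd: "1 \<le> \<kappa> * (m' k * m' l)" for k l
  proof -
    have "1 \<le> m' k * m' l" using m'[of k] m'[of l] by simp
    then have "1 \<le> real (m' k * m' l)" by linarith
    then have "1 * 1 \<le> \<kappa> * real (m' k * m' l)" using \<kappa>1 by (intro mult_mono) linarith+
    then show ?thesis by simp
  qed
  have ddd: "L'.N (Lab_a i) (Lab_a j) (Lab_a k) \<le> \<kappa> * (m' i * m' j * m' k)" for i j k
  proof (cases "m' i * m' j * m' k = 1")
    case True
    then have "L'.N (Lab_a i) (Lab_a j) (Lab_a k) \<le> 1" by (intro L'.N_le_1) simp_all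
    then show ?thesis using \<kappa>1 by (simp only: True)
  next
    case False
    moreover have "0 < m' i * m' j * m' k" using L'.half_dim_pos by simp
    ultimately have "2 \<le> m' i * m' j * m' k" by linarith
    then have "2 \<le> real (m' i * m' j * m' k)" by linarith
    then have "\<kappa> * 2 \<le> \<kappa> * real (m' i * m' j * m' k)" using \<kappa>1 by (intro mult_left_mono) linarith+
    then show ?thesis using le[of i j k] by simp
  qed
  have nonneg: "0 \<le> V i j k" for i j k
  proof -
    have "0 \<le> \<kappa>" using \<kappa>1 by simp
    have "V i j k \<in> {0..}"
    proof (rule verlinde_block_in[OF real_modular_glued]; (unfold V_formula atLeast_iff)?)
      show "0 \<le> \<kappa> * (m' k * m' l) - (if k = l then 1 else 0)" for k l
        using bdd[of k l] by (cases "k = l") simp_all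
      show "0 \<le> \<kappa> * (m' i * m' j * m' k) - L'.N (Lab_a i) (Lab_a j) (Lab_a k)" for i j k
        using ddd[of i j k] by simp
      show "0 \<le> \<kappa> * (m i * m j * m k) + L.N (Lab_a i) (Lab_a j) (Lab_a k)" for i j k
        using \<open>0 \<le> \<kappa>\<close> N by (intro add_nonneg_nonneg mult_nonneg_nonneg) simp_all
    qed (use \<open>0 \<le> \<kappa>\<close> in simp_all)
    then show ?thesis by simp
  qed
  show ?thesis using int nonneg by (simp add: Nats_altdef2)
qed

end

section \<open>The three assertions\<close>

theorem proposition2:
  fixes S T :: "complex^'p^'p" and z :: "'p::finite"
    and e :: "('m::finite, 'n::finite) lam_index \<Rightarrow> 'p"
    and x :: real and r :: complex
    and a :: "real^'m" and d :: "real^'n" and A :: "real^'m^'m" and D :: "real^'n^'n"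
    and s :: "complex^'m" and t :: "complex^'n"
    and S' T' :: "complex^'p2^'p2" and z' :: "'p2::finite"
    and e' :: "('m2::finite, 'n2::finite) lam_index \<Rightarrow> 'p2"
    and x' :: real and r' :: complex
    and a' :: "real^'m2" and d' :: "real^'n2" and A' :: "real^'m2^'m2" and D' :: "real^'n2^'n2"
    and s' :: "complex^'m2" and t' :: "complex^'n2"
  assumes "Z2_laminated z S T e"
    and "reindex e S = block_S x x a d A D" and "reindex e T = block_T r s t"
    and "Z2_laminated z' S' T' e'"
    and "reindex e' S' = block_S x' x' a' d' A' D'" and "reindex e' T' = block_T r' s' t'"
  shows
    "((\<exists>M L N. laminated_integers x a d M L N) \<and> (\<exists>M' L' N'. laminated_integers x' a' d' M' L' N'))
     \<and>
     (x = x' \<and> r = r' \<longrightarrow>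
        modular_data Lab_0 (block_S x x a d' A D') (block_T r s t') \<and>
        unitary_real Lab_0 (block_S x x a d' A D'))
     \<and>
     (\<forall>\<omega>. x > x' \<and> \<omega> ^ 3 = 1 \<and> r = - (r' * \<omega>) \<longrightarrow>
        (let Sh = block_S (x - x') (x + x') a a' A (- A');
             Th = block_T r s (\<chi> k. - \<omega> * s' $ k)
         in
           pre_modular_data Lab_0 Sh Th \<and> unitary_real Lab_0 Sh \<and>
           (\<forall>M L N M' L' N'.
              laminated_integers x a d M L N \<and> laminated_integers x' a' d' M' L' N' \<longrightarrow>
              ((\<forall>i j k. fusion Lab_0 Sh i j k \<in> \<int>) \<longleftrightarrow> (M' - M) dvd 4 \<and> L > 0 \<and> L' > 0) \<and>
              ((M' - M) dvd 4 \<and> L > 0 \<and> L' > 0 \<and>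
               (\<forall>k1 k2 k3. Re (fusion3 z' S' (e' (Lab_a k1)) (e' (Lab_a k2)) (e' (Lab_a k3)))
                   \<le> 8 ^ L' / real_of_int (M' - M))
               \<longrightarrow> modular_data Lab_0 Sh Th))))"
proof -
  interpret L: laminated_block x r a d A D s t
    by (rule Z2_laminated_imp_block(1)[OF assms(1-3)])
  interpret L': laminated_block x' r' a' d' A' D' s' t'
    by (rule Z2_laminated_imp_block(1)[OF assms(4-6)])
  have b: "modular_data Lab_0 (block_S x x a d' A D') (block_T r s t') \<and>
      unitary_real Lab_0 (block_S x x a d' A D')" if "x = x'" "r = r'"
  proof -
    interpret H: laminated_block x r a d' A D' s t'
      using glue_same_vacuum[OF L.laminated_block_axioms] L'.laminated_block_axioms that by simp
    show ?thesis
      using H.R H.nat pre_modular_data_block_iff[of x x a d' A D' r s t']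
      by (simp add: modular_data_def fusion_block_S of_real_in_Nats_iff)
  qed
  have c: "let Sh = block_S (x - x') (x + x') a a' A (- A');
             Th = block_T r s (\<chi> k. - \<omega> * s' $ k)
         in
           pre_modular_data Lab_0 Sh Th \<and> unitary_real Lab_0 Sh \<and>
           (\<forall>M L N M' L' N'.
              laminated_integers x a d M L N \<and> laminated_integers x' a' d' M' L' N' \<longrightarrow>
              ((\<forall>i j k. fusion Lab_0 Sh i j k \<in> \<int>) \<longleftrightarrow> (M' - M) dvd 4 \<and> L > 0 \<and> L' > 0) \<and>
              ((M' - M) dvd 4 \<and> L > 0 \<and> L' > 0 \<and>
               (\<forall>k1 k2 k3. Re (fusion3 z' S' (e' (Lab_a k1)) (e' (Lab_a k2)) (e' (Lab_a k3)))
                   \<le> 8 ^ L' / real_of_int (M' - M))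
               \<longrightarrow> modular_data Lab_0 Sh Th))"
    if "x > x'" "\<omega> ^ 3 = 1" "r = - (r' * \<omega>)" for \<omega>
  proof -
    interpret P: laminated_pair x r a d A D s t x' r' a' d' A' D' s' t' \<omega>
      using that by unfold_locales
    define Sh where "Sh = block_S (x - x') (x + x') a a' A (- A')"
    define Th :: "complex^('m, 'm2) lam_index^('m, 'm2) lam_index"
      where "Th = block_T r s (\<chi> k. - \<omega> * s' $ k)"
    have pre: "pre_modular_data Lab_0 Sh Th \<and> unitary_real Lab_0 Sh"
      unfolding Sh_def Th_def pre_modular_data_block_iff by (rule P.real_modular_glued)
    have fus: "fusion Lab_0 Sh i j k = of_real (P.V i j k)" for i j k
      unfolding Sh_def by (rule fusion_block_S)
    have "((\<forall>i j k. fusion Lab_0 Sh i j k \<in> \<int>) \<longleftrightarrow> (M' - M) dvd 4 \<and> L > 0 \<and> L' > 0) \<and>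
          ((M' - M) dvd 4 \<and> L > 0 \<and> L' > 0 \<and>
            (\<forall>k1 k2 k3. Re (fusion3 z' S' (e' (Lab_a k1)) (e' (Lab_a k2)) (e' (Lab_a k3)))
               \<le> 8 ^ L' / real_of_int (M' - M))
            \<longrightarrow> modular_data Lab_0 Sh Th)"
      if "laminated_integers x a d M L N" "laminated_integers x' a' d' M' L' N'" for M L N M' L' N'
    proof -
      have params: "M = L.gdim" "L = 1" "M' = L'.gdim" "L' = 1"
        using L.laminated_integers_unique[OF that(1)] L'.laminated_integers_unique[OF that(2)] by simp_all
      \<comment> \<open>As \<open>L' = 1\<close>, the assumed bound on \<open>N'\<close> is \<open>2\<kappa>\<close>.\<close>
      have "8 / real_of_int (L'.gdim - L.gdim) = 2 * P.\<kappa>"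
        using P.kappa_gdim P.gdim_less by (simp add: field_simps)
      then have "modular_data Lab_0 Sh Th"
        if "(M' - M) dvd 4" "\<forall>k1 k2 k3. Re (fusion3 z' S' (e' (Lab_a k1)) (e' (Lab_a k2)) (e' (Lab_a k3)))
               \<le> 8 ^ L' / real_of_int (M' - M)"
        using that P.glued_fusion_nat pre
        by (simp add: modular_data_def params fus of_real_in_Nats_iff Z2_laminated_imp_block(2)[OF assms(4-6)])
      then show ?thesis
        using P.glued_fusion_integral_iff by (simp add: params fus of_real_in_Ints_iff)
    qed
    then show ?thesis
      using pre unfolding Let_def Sh_def[symmetric] Th_def[symmetric] by blast
  qed
  show ?thesis
    using L.laminated_integers_gdim L'.laminated_integers_gdim b c by blast
qed

end
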